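(* Let $\beta>1$, let $X=[0,1)$ and let $f_\beta:X\to X$ be the $\beta$-transformation $f_\beta(x)=\beta x\ (\mathrm{mod}\ 1)$. Let $\varphi\in C([0,1])$ be a continuous real-valued function and let $$\widehat X(\varphi,f_\beta)=\Big\{x\in X:\lim_{n\to\infty}\frac1n\sum_{i=0}^{n-1}\varphi(f_\beta^i(x))\text{ does not exist}\Big\}.$$ If $\widehat X(\varphi,f_\beta)\ne\emptyset$, then $h_{top}(\widehat X(\varphi,f_\beta))=\log\beta$.
   Context: Topological entropy of subsets is in the sense of Bowen and Pesin–Pitskel, suitable for maps with discontinuities. Let $Y=X\setminus\bigcup_{i\ge 0}f_\beta^{-i}(0)$, on which $f_\beta:Y\to Y$ is continuous; any point whose orbit reaches $0$ has convergent Birkhoff averages, so $\widehat X(\varphi,f_\beta)\subset Y$. With the Euclidean metric, let $B_n(x,\epsilon)=\{y:|f_\beta^i(x)-f_\beta^i(y)|<\epsilon,\ 0\le i\le n-1\}$. For $Z\subset Y$, $\alpha\in\mathbb{R}$, $\epsilon>0$, $N\in\mathbb{N}$, let $M(Z,\alpha,\epsilon,N)=\inf_\Gamma\sum_i e^{-\alpha n_i}$, the infimum being over all finite or countable collections $\Gamma=\{B_{n_i}(x_i,\epsilon)\}_i$ covering $Z$ with $x_i\in X$ and all $n_i\ge N$. Let $m(Z,\alpha,\epsilon)=\lim_{N\to\infty}M(Z,\alpha,\epsilon,N)$, $h_{top}(Z,\epsilon)=\inf\{\alpha:m(Z,\alpha,\epsilon)=0\}=\sup\{\alpha:m(Z,\alpha,\epsilon)=\infty\}$,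 and $h_{top}(Z)=\lim_{\epsilon\to0}h_{top}(Z,\epsilon)$. *)

theory Defs
  imports "HOL-Analysis.Analysis"
begin

definition bowen_ball :: "'a::metric_space set \<Rightarrow> ('a \<Rightarrow> 'a) \<Rightarrow> nat \<Rightarrow> 'a \<Rightarrow> real \<Rightarrow> 'a set" where
  "bowen_ball X f n x \<epsilon> = {y \<in> X. \<forall>i<n. dist ((f ^^ i) x) ((f ^^ i) y) < \<epsilon>}"

text \<open>A finite or countable collection of Bowen balls is a family indexed by an arbitrary set
  \<open>I\<close> of natural numbers, so that the empty family is allowed (it covers only the empty set).
  The sums and the infimum are taken in \<^typ>\<open>ennreal\<close>, where every sum exists.\<close>

definition ent_M ::
  "'a::metric_space set \<Rightarrow> ('a \<Rightarrow> 'a) \<Rightarrow> 'a set \<Rightarrow> real \<Rightarrow> real \<Rightarrow> nat \<Rightarrow> ennreal" where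
  "ent_M X f Z \<alpha> \<epsilon> N =
     Inf {(\<Sum>\<^sub>\<infinity>i\<in>I. ennreal (exp (- \<alpha> * real (n i)))) | (I :: nat set) x n.
            (\<forall>i\<in>I. x i \<in> X \<and> N \<le> n i) \<and> Z \<subseteq> (\<Union>i\<in>I. bowen_ball X f (n i) (x i) \<epsilon>)}"

definition ent_m :: "'a::metric_space set \<Rightarrow> ('a \<Rightarrow> 'a) \<Rightarrow> 'a set \<Rightarrow> real \<Rightarrow> real \<Rightarrow> ennreal" where
  "ent_m X f Z \<alpha> \<epsilon> = lim (\<lambda>N. ent_M X f Z \<alpha> \<epsilon> N)"

definition h_top_eps :: "'a::metric_space set \<Rightarrow> ('a \<Rightarrow> 'a) \<Rightarrow> 'a set \<Rightarrow> real \<Rightarrow> ereal" where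
  "h_top_eps X f Z \<epsilon> = Inf {ereal \<alpha> | \<alpha>. ent_m X f Z \<alpha> \<epsilon> = 0}"

definition h_top :: "'a::metric_space set \<Rightarrow> ('a \<Rightarrow> 'a) \<Rightarrow> 'a set \<Rightarrow> ereal" where
  "h_top X f Z = Lim (at_right 0) (\<lambda>\<epsilon>. h_top_eps X f Z \<epsilon>)"

definition beta_map :: "real \<Rightarrow> real \<Rightarrow> real" where
  "beta_map \<beta> x = frac (\<beta> * x)"

definition irregular_set :: "'a set \<Rightarrow> ('a \<Rightarrow> 'a) \<Rightarrow> ('a \<Rightarrow> real) \<Rightarrow> 'a set" where
  "irregular_set X f \<phi> = {x \<in> X. \<not> convergent (\<lambda>n. (\<Sum>i<n. \<phi> ((f ^^ i) x)) / real n)}"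

text \<open>The following lemmas show that the limits above exist, that the two descriptions
  of the critical value of \<open>\<alpha>\<close> agree, and that the irregular set
  of a \<open>\<beta>\<close>-transformation avoids all preimages of \<open>0\<close>, so that it is immaterial whether Bowen
  balls are taken in \<open>[0,1)\<close> or in the complement of these preimages.\<close>

lemma incseq_ent_M: "incseq (\<lambda>N. ent_M X f Z \<alpha> \<epsilon> N)"
proof (rule incseq_SucI)
  fix N
  show "ent_M X f Z \<alpha> \<epsilon> N \<le> ent_M X f Z \<alpha> \<epsilon> (Suc N)"
    unfolding ent_M_def by (rule Inf_superset_mono) (use Suc_leD in blast)
qed

lemma ent_M_tendsto_SUP: "(\<lambda>N. ent_M X f Z \<alpha> \<epsilon> N) \<longlonglongrightarrow> (SUP N. ent_M X f Z \<alpha> \<epsilon> N)"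
  by (rule LIMSEQ_SUP[OF incseq_ent_M])

lemma ent_m_eq_SUP: "ent_m X f Z \<alpha> \<epsilon> = (SUP N. ent_M X f Z \<alpha> \<epsilon> N)"
  unfolding ent_m_def by (rule limI[OF ent_M_tendsto_SUP])

lemma ent_M_antimono_eps:
  assumes "\<epsilon> \<le> \<epsilon>'"
  shows "ent_M X f Z \<alpha> \<epsilon>' N \<le> ent_M X f Z \<alpha> \<epsilon> N"
proof -
  have "bowen_ball X f n x \<epsilon> \<subseteq> bowen_ball X f n x \<epsilon>'" for n x
    using assms unfolding bowen_ball_def by force
  then have cover: "Z \<subseteq> (\<Union>i\<in>I. bowen_ball X f (n i) (x i) \<epsilon>')"
    if "Z \<subseteq> (\<Union>i\<in>I. bowen_ball X f (n i) (x i) \<epsilon>)" for I :: "nat set" and n x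
    using that by fastforce
  show ?thesis
    unfolding ent_M_def
  proof (rule Inf_superset_mono, rule subsetI)
    fix s
    assume "s \<in> {(\<Sum>\<^sub>\<infinity>i\<in>I. ennreal (exp (- \<alpha> * real (n i)))) | (I :: nat set) x n.
      (\<forall>i\<in>I. x i \<in> X \<and> N \<le> n i) \<and> Z \<subseteq> (\<Union>i\<in>I. bowen_ball X f (n i) (x i) \<epsilon>)}"
    then obtain I :: "nat set" and x n where
      "s = (\<Sum>\<^sub>\<infinity>i\<in>I. ennreal (exp (- \<alpha> * real (n i))))"
      "\<forall>i\<in>I. x i \<in> X \<and> N \<le> n i" "Z \<subseteq> (\<Union>i\<in>I. bowen_ball X f (n i) (x i) \<epsilon>)"
      by blast
    with cover[where I = I and n = n and x = x]
    show "s \<in> {(\<Sum>\<^sub>\<infinity>i\<in>I. ennreal (exp (- \<alpha> * real (n i)))) | (I :: nat set) x n.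
      (\<forall>i\<in>I. x i \<in> X \<and> N \<le> n i) \<and> Z \<subseteq> (\<Union>i\<in>I. bowen_ball X f (n i) (x i) \<epsilon>')}"
      by blast
  qed
qed

lemma h_top_eps_antimono:
  assumes "\<epsilon> \<le> \<epsilon>'"
  shows "h_top_eps X f Z \<epsilon>' \<le> h_top_eps X f Z \<epsilon>"
proof -
  have "ent_m X f Z \<alpha> \<epsilon>' \<le> ent_m X f Z \<alpha> \<epsilon>" for \<alpha>
    unfolding ent_m_eq_SUP by (intro SUP_mono') (rule ent_M_antimono_eps[OF assms])
  then have "ent_m X f Z \<alpha> \<epsilon>' = 0" if "ent_m X f Z \<alpha> \<epsilon> = 0" for \<alpha>
    using that by (metis le_zero_eq)
  then show ?thesis
    unfolding h_top_eps_def by (intro Inf_superset_mono) auto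
qed

lemma h_top_eps_tendsto_SUP:
  "((\<lambda>\<epsilon>. h_top_eps X f Z \<epsilon>) \<longlongrightarrow> (SUP \<epsilon>\<in>{0<..}. h_top_eps X f Z \<epsilon>)) (at_right 0)"
proof (rule order_tendstoI)
  fix a assume "a < (SUP \<epsilon>\<in>{0<..}. h_top_eps X f Z \<epsilon>)"
  then obtain \<epsilon>0 where e0: "\<epsilon>0 > 0" "a < h_top_eps X f Z \<epsilon>0"
    by (auto simp: less_SUP_iff)
  have "\<forall>\<^sub>F \<epsilon> in at_right 0. \<epsilon> < \<epsilon>0"
    using e0(1) eventually_at_right_field by blast
  then show "\<forall>\<^sub>F \<epsilon> in at_right 0. a < h_top_eps X f Z \<epsilon>"
    by eventually_elim (meson e0(2) h_top_eps_antimono less_imp_le less_le_trans)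
next
  fix a assume a: "(SUP \<epsilon>\<in>{0<..}. h_top_eps X f Z \<epsilon>) < a"
  have "\<forall>\<^sub>F \<epsilon> in at_right (0::real). \<epsilon> \<in> {0<..}"
    by (auto simp: eventually_at_filter)
  then show "\<forall>\<^sub>F \<epsilon> in at_right 0. h_top_eps X f Z \<epsilon> < a"
    by eventually_elim (meson a SUP_upper le_less_trans)
qed

lemma h_top_eq_SUP: "h_top X f Z = (SUP \<epsilon>\<in>{0<..}. h_top_eps X f Z \<epsilon>)"
  unfolding h_top_def by (rule tendsto_Lim[OF _ h_top_eps_tendsto_SUP]) simp

lemma ent_M_decay:
  assumes "\<alpha> \<le> \<alpha>'"
  shows "ent_M X f Z \<alpha>' \<epsilon> N \<le> ennreal (exp (- (\<alpha>' - \<alpha>) * real N)) * ent_M X f Z \<alpha> \<epsilon> N"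
proof -
  let ?c = "ennreal (exp (- (\<alpha>' - \<alpha>) * real N))"
  let ?A = "{(\<Sum>\<^sub>\<infinity>i\<in>I. ennreal (exp (- \<alpha> * real (n i)))) | (I :: nat set) x n.
            (\<forall>i\<in>I. x i \<in> X \<and> N \<le> n i) \<and> Z \<subseteq> (\<Union>i\<in>I. bowen_ball X f (n i) (x i) \<epsilon>)}"
  have le: "ent_M X f Z \<alpha>' \<epsilon> N \<le> ?c * s" if "s \<in> ?A" for s
  proof -
    from that obtain I :: "nat set" and x n where
      s: "s = (\<Sum>\<^sub>\<infinity>i\<in>I. ennreal (exp (- \<alpha> * real (n i))))"
      and I: "\<forall>i\<in>I. x i \<in> X \<and> N \<le> n i" "Z \<subseteq> (\<Union>i\<in>I. bowen_ball X f (n i) (x i) \<epsilon>)"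
      by blast
    have "ent_M X f Z \<alpha>' \<epsilon> N \<le> (\<Sum>\<^sub>\<infinity>i\<in>I. ennreal (exp (- \<alpha>' * real (n i))))"
      unfolding ent_M_def by (rule Inf_lower) (use I in blast)
    also have "\<dots> \<le> (\<Sum>\<^sub>\<infinity>i\<in>I. ?c * ennreal (exp (- \<alpha> * real (n i))))"
    proof (rule infsum_mono)
      fix i assume "i \<in> I"
      then have "(\<alpha>' - \<alpha>) * real N \<le> (\<alpha>' - \<alpha>) * real (n i)"
        using I assms by (intro mult_left_mono) auto
      then have "- \<alpha>' * real (n i) \<le> - (\<alpha>' - \<alpha>) * real N + - \<alpha> * real (n i)"
        by (simp add: algebra_simps)
      then have "exp (- \<alpha>' * real (n i)) \<le> exp (- (\<alpha>' - \<alpha>) * real N) * exp (- \<alpha> * real (n i))"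
        by (metis exp_add exp_le_cancel_iff)
      then show "ennreal (exp (- \<alpha>' * real (n i))) \<le> ?c * ennreal (exp (- \<alpha> * real (n i)))"
        by (metis ennreal_leI ennreal_mult exp_ge_zero)
    qed (auto intro: nonneg_summable_on_complete)
    also have "\<dots> = ?c * s"
      unfolding s by (simp add: nonneg_infsum_complete SUP_mult_left_ennreal sum_distrib_left del: sum_ennreal)
    finally show ?thesis .
  qed
  have "?c \<noteq> 0" "?c \<noteq> top" by auto
  have "ent_M X f Z \<alpha>' \<epsilon> N / ?c \<le> Inf ?A"
  proof (rule Inf_greatest)
    fix s assume "s \<in> ?A"
    from divide_right_mono_ennreal[OF le[OF this], of ?c]
    show "ent_M X f Z \<alpha>' \<epsilon> N / ?c \<le> s"
      by (simp add: \<open>?c \<noteq> 0\<close> \<open>?c \<noteq> top\<close> ennreal_mult_divide_eq mult.commute)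
  qed
  from mult_left_mono[OF this, of ?c] have "?c * (ent_M X f Z \<alpha>' \<epsilon> N / ?c) \<le> ?c * Inf ?A"
    by simp
  moreover have "?c * (t / ?c) = t" for t
    using \<open>?c \<noteq> 0\<close> \<open>?c \<noteq> top\<close>
    by (metis ennreal_mult_divide_eq ennreal_times_divide mult.commute)
  ultimately show ?thesis
    unfolding ent_M_def[of X f Z \<alpha> \<epsilon> N] by simp
qed

lemma ent_m_critical:
  assumes "\<alpha> < \<alpha>'" "ent_m X f Z \<alpha> \<epsilon> \<noteq> top"
  shows "ent_m X f Z \<alpha>' \<epsilon> = 0"
proof -
  let ?c = "\<lambda>N. ennreal (exp (- (\<alpha>' - \<alpha>) * real N))"
  have "(\<lambda>N. exp (- (\<alpha>' - \<alpha>)) ^ N) \<longlonglongrightarrow> 0"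
    by (rule LIMSEQ_power_zero) (use assms in auto)
  then have "(\<lambda>N. exp (- (\<alpha>' - \<alpha>) * real N)) \<longlonglongrightarrow> 0"
    by (simp only: exp_of_nat2_mult)
  then have "?c \<longlonglongrightarrow> ennreal 0" by (rule tendsto_ennrealI)
  then have "(\<lambda>N. ent_m X f Z \<alpha> \<epsilon> * ?c N) \<longlonglongrightarrow> ent_m X f Z \<alpha> \<epsilon> * ennreal 0"
    using assms(2) by (intro ennreal_tendsto_cmult) (simp_all add: less_top)
  then have lim0: "(\<lambda>N. ?c N * ent_m X f Z \<alpha> \<epsilon>) \<longlonglongrightarrow> 0" by (simp add: mult.commute)
  have "ent_M X f Z \<alpha>' \<epsilon> N \<le> ?c N * ent_m X f Z \<alpha> \<epsilon>" for N
    using ent_M_decay[of \<alpha> \<alpha>' X f Z \<epsilon> N] assms(1)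
    by (smt (verit) SUP_upper UNIV_I ent_m_eq_SUP mult_left_mono order_trans zero_le)
  then have "(SUP N. ent_M X f Z \<alpha>' \<epsilon> N) \<le> 0"
    by (intro LIMSEQ_le[OF ent_M_tendsto_SUP lim0]) auto
  then show ?thesis by (simp add: ent_m_eq_SUP)
qed

lemma h_top_eps_eq_Sup: "h_top_eps X f Z \<epsilon> = Sup {ereal \<alpha> | \<alpha>. ent_m X f Z \<alpha> \<epsilon> = \<infinity>}"
proof (rule antisym)
  show "Sup {ereal \<alpha> | \<alpha>. ent_m X f Z \<alpha> \<epsilon> = \<infinity>} \<le> h_top_eps X f Z \<epsilon>"
    unfolding h_top_eps_def
  proof (intro Sup_least Inf_greatest)
    fix a b assume "a \<in> {ereal \<alpha> | \<alpha>. ent_m X f Z \<alpha> \<epsilon> = \<infinity>}" "b \<in> {ereal \<alpha> | \<alpha>. ent_m X f Z \<alpha> \<epsilon> = 0}"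
    then obtain \<alpha> \<beta> where ab: "a = ereal \<alpha>" "b = ereal \<beta>" "ent_m X f Z \<alpha> \<epsilon> = \<infinity>" "ent_m X f Z \<beta> \<epsilon> = 0"
      by auto
    then have "\<not> \<beta> < \<alpha>" using ent_m_critical[of \<beta> \<alpha> X f Z \<epsilon>] by auto
    then show "a \<le> b" using ab by simp
  qed
next
  show "h_top_eps X f Z \<epsilon> \<le> Sup {ereal \<alpha> | \<alpha>. ent_m X f Z \<alpha> \<epsilon> = \<infinity>}" (is "_ \<le> ?S")
  proof (rule ccontr)
    assume "\<not> ?thesis"
    then have "?S < h_top_eps X f Z \<epsilon>" by simp
    then obtain r1 where r1: "?S < ereal r1" "ereal r1 < h_top_eps X f Z \<epsilon>"
      using ereal_dense2 by blast
    then obtain r2 where r2: "ereal r1 < ereal r2" "ereal r2 < h_top_eps X f Z \<epsilon>"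
      using ereal_dense2 by blast
    have "ent_m X f Z r1 \<epsilon> \<noteq> \<infinity>"
      using r1(1) by (metis (mono_tags, lifting) Sup_upper leD mem_Collect_eq)
    then have "ent_m X f Z r2 \<epsilon> = 0"
      using r2(1) ent_m_critical[of r1 r2 X f Z \<epsilon>] by auto
    then have "h_top_eps X f Z \<epsilon> \<le> ereal r2"
      unfolding h_top_eps_def by (intro Inf_lower) auto
    then show False using r2(2) by simp
  qed
qed

lemma irregular_set_beta_subset:
  "irregular_set {0..<1} (beta_map \<beta>) \<phi> \<subseteq> {0..<1} - (\<Union>i. (beta_map \<beta> ^^ i) -` {0})"
proof -
  have "convergent (\<lambda>n. (\<Sum>i<n. \<phi> ((beta_map \<beta> ^^ i) x)) / real n)"
    if k: "(beta_map \<beta> ^^ k) x = 0" for k x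
  proof -
    let ?S = "\<lambda>n. (\<Sum>i<n. \<phi> ((beta_map \<beta> ^^ i) x))"
    have "beta_map \<beta> 0 = 0" by (simp add: beta_map_def)
    then have z: "(beta_map \<beta> ^^ (j + k)) x = 0" for j
      by (induction j) (simp_all add: k)
    have S: "?S (j + k) = ?S k + real j * \<phi> 0" for j
      by (induction j) (simp_all add: z algebra_simps)
    have "(\<lambda>n. (?S k - real k * \<phi> 0) / real n + \<phi> 0) \<longlonglongrightarrow> 0 + \<phi> 0"
      by (intro tendsto_add tendsto_const lim_const_over_n)
    moreover have "\<forall>\<^sub>F n in sequentially. (?S k - real k * \<phi> 0) / real n + \<phi> 0 = ?S n / real n"
      using eventually_ge_at_top[of "Suc k"]
    proof eventually_elim
      case (elim n)
      then have "?S n = ?S k + real (n - k) * \<phi> 0" using S[of "n - k"] by simp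
      also have "\<dots> = (?S k - real k * \<phi> 0) + \<phi> 0 * real n"
        using elim by (simp add: of_nat_diff algebra_simps)
      finally show ?case using elim by (simp add: add_divide_distrib)
    qed
    ultimately have "(\<lambda>n. ?S n / real n) \<longlonglongrightarrow> 0 + \<phi> 0"
      by (rule Lim_transform_eventually)
    then show ?thesis by (rule convergentI)
  qed
  then show ?thesis by (auto simp: irregular_set_def)
qed

end

theory Submission
  imports Defs "HOL-Probability.Infinite_Product_Measure"
begin

text \<open>Call a word full if \<open>f\<close> maps its cylinder onto all of \<open>[0,1)\<close>; full words
  can be concatenated freely, and since \<open>f ^^ n\<close> vanishes at the left end point \<open>a\<close> of a full
  cylinder of length \<open>n\<close>, such a word is represented by the number \<open>a\<close>. Lowering the last nonzero
  digit of the initial \<open>n\<close>-word of a point makes the word full and changes the orbit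
  by a summable amount. Hence there are at least \<open>\<beta> ^ n / (n + 1)\<close> full words of length \<open>n\<close>, and
  one irregular point yields two full words \<open>P\<close> and \<open>Q\<close> with different Birkhoff averages.
  Given any sequence of long full words \<open>u k\<close>, append to each of them a comparatively short power of
  \<open>P\<close> or \<open>Q\<close>. The difference of the Birkhoff sums of two such points with the same \<open>u\<close> is governed
  by the choices of \<open>P\<close> and \<open>Q\<close> alone, so the point using only \<open>P\<close> and the point switching between
  \<open>P\<close> and \<open>Q\<close> in stages of factorial length cannot both be regular. One irregular point
  for every sequence \<open>u\<close> is enough for the mass distribution principle, which gives entropy close to
  \<open>ln \<beta>\<close>.\<close>

section \<open>Averages and covers of sequence spaces\<close>

text \<open>Uniform continuity handles points at distance below some \<open>d\<close>; farther
  apart, the difference is at most \<open>2 * B\<close>, which the slope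
  \<open>K = 2 * B / d\<close> absorbs. In this linear form the bound can be summed along two
  orbits.\<close>

lemma compact_modulus_of_continuity:
  fixes \<phi> :: "'a::metric_space \<Rightarrow> real"
  assumes "compact S" "continuous_on S \<phi>" "0 < \<eta>"
  obtains K where "0 \<le> K" "\<And>x y. x \<in> S \<Longrightarrow> y \<in> S \<Longrightarrow> \<bar>\<phi> x - \<phi> y\<bar> \<le> \<eta> + K * dist x y"
proof -
  obtain d where d: "0 < d" "\<And>x y. x \<in> S \<Longrightarrow> y \<in> S \<Longrightarrow> dist x y < d \<Longrightarrow> \<bar>\<phi> x - \<phi> y\<bar> < \<eta>"
    using compact_uniformly_continuous[OF assms(2,1)] assms(3)
    unfolding uniformly_continuous_on_def dist_real_def by (metis dist_commute)
  obtain B where B: "0 < B" "\<And>x. x \<in> S \<Longrightarrow> \<bar>\<phi> x\<bar> \<le> B"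
    using compact_imp_bounded[OF compact_continuous_image[OF assms(2,1)]]
    unfolding bounded_pos by auto
  have "\<bar>\<phi> x - \<phi> y\<bar> \<le> \<eta> + 2 * B / d * dist x y" if xy: "x \<in> S" "y \<in> S" for x y
  proof (cases "dist x y < d")
    case True
    then have "\<bar>\<phi> x - \<phi> y\<bar> < \<eta>" using d xy by blast
    moreover have "0 \<le> 2 * B / d * dist x y" using B d by simp
    ultimately show ?thesis by linarith
  next
    case False
    then have "2 * B / d * d \<le> 2 * B / d * dist x y"
      using B(1) d(1) by (intro mult_left_mono) auto
    then show ?thesis using B(2)[OF xy(1)] B(2)[OF xy(2)] d(1) assms(3) by simp
  qed
  then show thesis using B(1) d(1) by (intro that[of "2 * B / d"]) auto
qed

text \<open>Boundedness makes the lower and upper limits finite, so failure of convergence separates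
  them; \<open>a < b\<close> are chosen strictly between the two.\<close>

lemma nonconvergent_bounded_gap:
  fixes s :: "nat \<Rightarrow> real"
  assumes "\<not> convergent s" "\<And>n. \<bar>s n\<bar> \<le> M"
  obtains a b where "a < b" "\<exists>\<^sub>F n in sequentially. s n < a" "\<exists>\<^sub>F n in sequentially. b < s n"
proof -
  let ?s = "\<lambda>n. ereal (s n)"
  have bd: "ereal (- M) \<le> liminf ?s" "limsup ?s \<le> ereal M"
    using assms(2) by (auto intro!: Liminf_bounded Limsup_bounded always_eventually simp: abs_le_iff minus_le_iff)
  have le: "liminf ?s \<le> limsup ?s" by (simp add: Liminf_le_Limsup)
  have "liminf ?s \<noteq> limsup ?s"
  proof
    assume eq: "liminf ?s = limsup ?s"
    obtain l where "liminf ?s = ereal l"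
      using bd(1) bd(2)[folded eq] by (cases "liminf ?s") auto
    then have "?s \<longlonglongrightarrow> ereal l"
      by (subst tendsto_iff_Liminf_eq_Limsup) (simp_all flip: eq)
    then show False using assms(1) by (auto simp: convergent_def)
  qed
  then obtain c where c: "liminf ?s < ereal c" "ereal c < limsup ?s"
    using le ereal_dense2 by (metis order_less_le)
  obtain d where d: "ereal c < ereal d" "ereal d < limsup ?s" using c(2) ereal_dense2 by blast
  show thesis
  proof (rule that[of c d])
    show "\<exists>\<^sub>F n in sequentially. s n < c"
      using c(1) Liminf_bounded[of "ereal c" ?s sequentially]
      by (auto simp: frequently_def not_less linorder_not_le[symmetric])
    show "\<exists>\<^sub>F n in sequentially. d < s n"
      using d(2) Limsup_bounded[of ?s "ereal d" sequentially]
      by (auto simp: frequently_def not_less linorder_not_le[symmetric])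
  qed (use d in simp)
qed

text \<open>The first \<open>fact m\<close> terms are only the fraction \<open>1 / Suc m\<close> of
  all \<open>fact (Suc m)\<close> terms, so using the crude bound \<open>M\<close> on them adds just
  \<open>(M - e) / Suc m\<close>.\<close>

lemma average_fact_le:
  fixes d :: "nat \<Rightarrow> real"
  assumes "\<And>i. \<bar>d i\<bar> \<le> M" "\<And>i. fact m \<le> i \<Longrightarrow> i < fact (Suc m) \<Longrightarrow> d i \<le> e"
  shows "(\<Sum>i<fact (Suc m). d i) / fact (Suc m) \<le> e + (M - e) / Suc m"
proof -
  let ?N = "fact (Suc m) :: nat"
  have le: "fact m \<le> ?N" by (rule fact_mono) simp
  have "(\<Sum>i<?N. d i) = (\<Sum>i<fact m. d i) + (\<Sum>i=fact m..<?N. d i)"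
    using le by (metis lessThan_atLeast0 sum.atLeastLessThan_concat zero_le)
  also have "\<dots> \<le> (\<Sum>i\<in>{..<fact m :: nat}. M) + (\<Sum>i=fact m..<?N. e)"
  proof (rule add_mono)
    show "(\<Sum>i<fact m. d i) \<le> (\<Sum>i\<in>{..<fact m :: nat}. M)"
      by (rule sum_mono) (use assms(1) in \<open>simp add: abs_le_iff\<close>)
    show "(\<Sum>i=fact m..<?N. d i) \<le> (\<Sum>i=fact m..<?N. e)"
      by (rule sum_mono) (use assms(2) in simp)
  qed
  also have "\<dots> = fact m * M + (fact (Suc m) - fact m) * e"
    using le by (simp add: of_nat_diff del: fact_Suc)
  also have "\<dots> = fact (Suc m) * (e + (M - e) / Suc m)"
    by (simp add: field_simps del: of_nat_Suc)
  finally show ?thesis by (simp add: field_simps del: fact_Suc of_nat_Suc)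
qed

lemma ex_oscillating_pattern:
  obtains P :: "nat \<Rightarrow> bool" where
    "\<And>d e g M. e < g \<Longrightarrow> (\<And>i. \<bar>d i\<bar> \<le> (M :: real)) \<Longrightarrow> (\<And>i. \<not> P i \<Longrightarrow> d i \<le> e) \<Longrightarrow>
      (\<And>i. P i \<Longrightarrow> g \<le> d i) \<Longrightarrow> \<not> convergent (\<lambda>n. (\<Sum>i<n. d i) / real n)"
proof
  \<comment> \<open>\<open>P\<close> marks the factorial stages of even index. It is fixed before
    \<open>d\<close>, so one pattern serves every bounded sequence that it separates.\<close>
  define P where "P = (\<lambda>i :: nat. \<exists>k. fact (2 * k) \<le> i \<and> i < fact (Suc (2 * k)))"
  fix d :: "nat \<Rightarrow> real" and e g M
  assume eg: "e < g" and M: "\<And>i. \<bar>d i\<bar> \<le> M" and lo: "\<And>i. \<not> P i \<Longrightarrow> d i \<le> e" and hi: "\<And>i. P i \<Longrightarrow> g \<le> d i"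
  let ?a = "\<lambda>n. (\<Sum>i<n. d i) / real n"
  have not: "\<not> P i" if i: "fact (Suc (2 * k)) \<le> i" "i < fact (Suc (Suc (2 * k)))" for i k
  proof
    assume "P i"
    then obtain l where l: "fact (2 * l) \<le> i" "i < fact (Suc (2 * l))" unfolding P_def by blast
    show False
    proof (cases "l \<le> k")
      case True
      then have "fact (Suc (2 * l)) \<le> (fact (Suc (2 * k)) :: nat)" by (intro fact_mono) simp
      then show False using l i by linarith
    next
      case False
      then have "fact (Suc (Suc (2 * k))) \<le> (fact (2 * l) :: nat)" by (intro fact_mono) simp
      then show False using l i by linarith
    qed
  qed
  show "\<not> convergent ?a"
  proof
    assume "convergent ?a"
    then obtain l where l: "?a \<longlonglongrightarrow> l" by (auto simp: convergent_def)
    have top: "filterlim (\<lambda>k. Suc (2 * k + j)) sequentially sequentially" for j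
      by (rule filterlim_subseq) (simp add: strict_mono_def)
    have ftop: "filterlim (\<lambda>n. fact n :: nat) sequentially sequentially"
      by (rule filterlim_at_top_mono[OF filterlim_ident]) (simp add: fact_ge_self)
    have sub: "(\<lambda>k. ?a (fact (Suc (2 * k + j)))) \<longlonglongrightarrow> l" for j
      using filterlim_compose[OF l filterlim_compose[OF ftop top]] .
    have lim: "(\<lambda>k. x + y / real (Suc (2 * k + j))) \<longlonglongrightarrow> x + 0" for x y :: real and j
      by (intro tendsto_add tendsto_const filterlim_compose[OF lim_const_over_n top])
    have "l \<le> e + 0"
    proof (rule LIMSEQ_le[OF sub[of 1] lim[of e "M - e" 1]], intro exI allI impI)
      fix k
      show "?a (fact (Suc (2 * k + 1))) \<le> e + (M - e) / real (Suc (2 * k + 1))"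
        using average_fact_le[where d = d and M = M and m = "2 * k + 1" and e = e] M lo not[of k] by (simp del: fact_Suc of_nat_Suc)
    qed
    moreover have "g + 0 \<le> l"
    proof (rule LIMSEQ_le[OF lim[of g "- (M + g)" 0] sub[of 0]], intro exI allI impI)
      fix k
      have "P i" if "fact (2 * k) \<le> i" "i < fact (Suc (2 * k))" for i
        using that unfolding P_def by blast
      \<comment> \<open>The lower bound on \<open>P\<close>-stages is the upper bound of
        \<open>average_fact_le\<close> for \<open>- d\<close>.\<close>
      then have "(\<Sum>i<fact (Suc (2 * k)). - d i) / fact (Suc (2 * k)) \<le> - g + (M - - g) / Suc (2 * k)"
        using M hi by (intro average_fact_le) auto
      then have "- ?a (fact (Suc (2 * k))) \<le> - g + (M + g) / real (Suc (2 * k))"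
        by (simp add: sum_negf del: fact_Suc of_nat_Suc)
      then show "g + - (M + g) / real (Suc (2 * k + 0)) \<le> ?a (fact (Suc (2 * k + 0)))"
        unfolding minus_divide_left[symmetric] add_0_right by linarith
    qed
    ultimately show False using eg by simp
  qed
qed

lemma infsum_ennreal_eq_suminf:
  fixes g :: "nat \<Rightarrow> ennreal"
  shows "infsum g I = (\<Sum>i. if i \<in> I then g i else 0)"
proof -
  have "infsum g I = infsum (\<lambda>i. if i \<in> I then g i else 0) UNIV"
    by (rule infsum_cong_neutral) auto
  moreover have "((\<lambda>i. if i \<in> I then g i else 0) has_sum infsum (\<lambda>i. if i \<in> I then g i else 0) UNIV) UNIV"
    by (intro has_sum_infsum nonneg_summable_on_complete) simp
  ultimately show ?thesis using has_sum_imp_sums sums_unique by metis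
qed

text \<open>The mass distribution principle for the uniform Bernoulli measure: the sets need not
  be measurable, but each of them lies in a cylinder.\<close>

lemma sequence_cover_mass:
  fixes C :: "nat \<Rightarrow> (nat \<Rightarrow> 'a) set"
  assumes U: "finite U" "U \<noteq> {}"
    and cover: "\<And>u. \<forall>k. u k \<in> U \<Longrightarrow> \<exists>i\<in>I. u \<in> C i"
    and agree: "\<And>i u v k. i \<in> I \<Longrightarrow> u \<in> C i \<Longrightarrow> v \<in> C i \<Longrightarrow> k < j i \<Longrightarrow> u k = v k"
  shows "1 \<le> (\<Sum>\<^sub>\<infinity>i\<in>I. ennreal (1 / real (card U) ^ j i))"
proof -
  interpret prob_space "uniform_count_measure U"
    using U by (intro prob_space_uniform_count_measure)
  interpret P: product_prob_space "\<lambda>_. uniform_count_measure U" "UNIV :: nat set"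
    by unfold_locales
  let ?P = "PiM UNIV (\<lambda>_ :: nat. uniform_count_measure U)"
  have space: "u \<in> space ?P \<longleftrightarrow> (\<forall>k. u k \<in> U)" for u
    by (simp add: space_PiM PiE_UNIV_domain Pi_iff space_uniform_count_measure)
  define c where "c = (\<lambda>i. SOME u. u \<in> C i)"
  \<comment> \<open>If \<open>C i\<close> is empty, \<open>c i\<close> is an arbitrary sequence
    whose values may lie outside \<open>U\<close>; intersecting with \<open>U\<close> keeps
    \<open>E i\<close> measurable and its mass bounded in that case too.\<close>
  define E where "E = (\<lambda>i. {u \<in> space ?P. \<forall>k\<in>{..<j i}. u k \<in> {c i k} \<inter> U})"
  have sing: "{c i k} \<inter> U \<in> sets (uniform_count_measure U)" for i k
    by (simp add: sets_uniform_count_measure)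
  have E: "E i \<in> sets ?P" for i
    unfolding E_def using sing by (intro sets.sets_Collect_finite_All sets_Collect_single) auto
  have emE: "emeasure ?P (E i) \<le> ennreal (1 / real (card U) ^ j i)" for i
  proof -
    have "emeasure ?P (E i) = (\<Prod>k\<in>{..<j i}. emeasure (uniform_count_measure U) ({c i k} \<inter> U))"
      unfolding E_def using sing by (intro P.emeasure_PiM_Collect) auto
    also have "\<dots> \<le> (\<Prod>k\<in>{..<j i}. ennreal (1 / real (card U)))"
    proof (rule prod_mono_ennreal)
      fix k
      have "card ({c i k} \<inter> U) \<le> 1" using card_mono[of "{c i k}" "{c i k} \<inter> U"] by simp
      then show "emeasure (uniform_count_measure U) ({c i k} \<inter> U) \<le> ennreal (1 / real (card U))"
        using U by (simp add: emeasure_uniform_count_measure divide_right_mono ennreal_leI)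
    qed
    also have "\<dots> = ennreal (1 / real (card U) ^ j i)"
      by (simp add: ennreal_power power_one_over[symmetric])
    finally show ?thesis .
  qed
  have "1 = emeasure ?P (space ?P)" by (simp add: P.emeasure_space_1)
  also have "\<dots> \<le> emeasure ?P (\<Union>i. if i \<in> I then E i else {})"
  proof (rule emeasure_mono)
    show "space ?P \<subseteq> (\<Union>i. if i \<in> I then E i else {})"
    proof
      fix u assume u: "u \<in> space ?P"
      then obtain i where i: "i \<in> I" "u \<in> C i" using cover space by blast
      have "c i \<in> C i" using i(2) unfolding c_def by (metis someI_ex)
      have "u k \<in> {c i k} \<inter> U" if "k < j i" for k
      proof -
        have "u k \<in> U" using u space by blast
        moreover have "u k = c i k" using agree[OF i \<open>c i \<in> C i\<close> that] .
        ultimately show ?thesis by blast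
      qed
      then have "u \<in> E i" using u unfolding E_def by blast
      then show "u \<in> (\<Union>i. if i \<in> I then E i else {})" using i(1) by (intro UN_I[of i]) auto
    qed
    show "(\<Union>i. if i \<in> I then E i else {}) \<in> sets ?P" using E by (intro sets.countable_UN) auto
  qed
  also have "\<dots> \<le> (\<Sum>i. emeasure ?P (if i \<in> I then E i else {}))"
    using E by (intro emeasure_subadditive_countably) auto
  also have "\<dots> \<le> (\<Sum>i. if i \<in> I then ennreal (1 / real (card U) ^ j i) else 0)"
    using emE by (intro suminf_le summableI) auto
  also have "\<dots> = (\<Sum>\<^sub>\<infinity>i\<in>I. ennreal (1 / real (card U) ^ j i))"
    by (rule infsum_ennreal_eq_suminf[symmetric])
  finally show ?thesis .
qed

section \<open>Full words\<close>

locale beta_transformation =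
  fixes \<beta> :: real
  assumes beta_gt_1: "1 < \<beta>"
begin

abbreviation f :: "real \<Rightarrow> real" where
  "f \<equiv> beta_map \<beta>"

lemma beta_pos [simp]: "0 < \<beta>" "0 \<le> \<beta>" "\<beta> \<noteq> 0" "0 < \<beta> - 1"
  using beta_gt_1 by auto

lemma f_eqI:
  assumes "\<beta> * x = of_int k + y" "0 \<le> y" "y < 1"
  shows "f x = y"
  using assms unfolding beta_map_def by (simp add: frac_unique_iff)

lemma f_decomp:
  assumes "0 \<le> x"
  obtains d :: int where "0 \<le> d" "x = (of_int d + f x) / \<beta>" "0 \<le> f x" "f x < 1"
    "\<beta> * x = of_int d + f x"
proof
  show "0 \<le> \<lfloor>\<beta> * x\<rfloor>" using assms by simp
  show *: "\<beta> * x = of_int \<lfloor>\<beta> * x\<rfloor> + f x" by (simp add: beta_map_def frac_def)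
  show "x = (of_int \<lfloor>\<beta> * x\<rfloor> + f x) / \<beta>" by (simp flip: *)
  show "0 \<le> f x" "f x < 1" by (simp_all add: beta_map_def frac_lt_1)
qed

lemma f_0 [simp]: "f 0 = 0"
  by (simp add: beta_map_def)

lemma iterate_0 [simp]: "(f ^^ i) 0 = 0"
  by (induction i) auto

lemma iterate_in_unit: "x \<in> {0..<1} \<Longrightarrow> (f ^^ i) x \<in> {0..<1}"
  by (cases i) (auto simp: beta_map_def frac_lt_1)

lemma iterate_Suc: "(f ^^ Suc i) x = (f ^^ i) (f x)"
  by (simp add: funpow_swap1)

text \<open>As long as no branch point is crossed, the \<open>i\<close>-th image of
  \<open>cyl n a\<close> is an interval of length \<open>\<beta> ^ i / \<beta> ^ n\<close> starting
  at \<open>(f ^^ i) a\<close>. The last condition keeps all these intervals inside the unit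
  interval.\<close>

definition full :: "nat \<Rightarrow> real \<Rightarrow> bool" where
  "full n a \<longleftrightarrow> 0 \<le> a \<and> (f ^^ n) a = 0 \<and> (\<forall>i\<le>n. (f ^^ i) a + \<beta> ^ i / \<beta> ^ n \<le> 1)"

definition cyl :: "nat \<Rightarrow> real \<Rightarrow> real set" where
  "cyl n a = {a..<a + 1 / \<beta> ^ n}"

lemma fullD:
  assumes "full n a"
  shows "0 \<le> a" "(f ^^ n) a = 0" "a + 1 / \<beta> ^ n \<le> 1" "a < 1" "a \<in> cyl n a"
proof -
  show "0 \<le> a" "(f ^^ n) a = 0" using assms by (auto simp: full_def)
  show *: "a + 1 / \<beta> ^ n \<le> 1" using assms by (auto simp: full_def dest!: spec[of _ 0])
  have "0 < 1 / \<beta> ^ n" by simp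
  with * show "a < 1" by linarith
  show "a \<in> cyl n a" using \<open>0 < 1 / \<beta> ^ n\<close> by (simp add: cyl_def)
qed

lemma cyl_subset: "full n a \<Longrightarrow> cyl n a \<subseteq> {0..<1}"
  using fullD[of n a] by (auto simp: cyl_def)

lemma full_0 [simp]: "full n 0"
  using beta_gt_1 by (auto simp: full_def power_increasing)

text \<open>Prepending the digit \<open>d\<close> adds only the condition for \<open>i = 0\<close>;
  those for later iterates are the conditions for \<open>a\<close>.\<close>

lemma full_Cons:
  assumes "full n a" "0 \<le> d" "(of_int d + a) / \<beta> + 1 / \<beta> ^ Suc n \<le> 1"
  shows "full (Suc n) ((of_int d + a) / \<beta>)" "f ((of_int d + a) / \<beta>) = a"
proof -
  show f: "f ((of_int d + a) / \<beta>) = a"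
    by (rule f_eqI[of _ d]) (use fullD[OF assms(1)] in auto)
  have "(f ^^ i) ((of_int d + a) / \<beta>) + \<beta> ^ i / \<beta> ^ Suc n \<le> 1" if "i \<le> Suc n" for i
  proof (cases i)
    case 0
    then show ?thesis using assms(3) by simp
  next
    case (Suc j)
    then have "(f ^^ j) a + \<beta> ^ j / \<beta> ^ n \<le> 1" using assms(1) that by (auto simp: full_def)
    then show ?thesis by (simp add: Suc iterate_Suc f del: funpow.simps)
  qed
  moreover have "0 \<le> (of_int d + a) / \<beta>" using assms(2) fullD(1)[OF assms(1)] by simp
  ultimately show "full (Suc n) ((of_int d + a) / \<beta>)"
    using fullD(2)[OF assms(1)] by (auto simp: full_def iterate_Suc f simp del: funpow.simps)
qed

text \<open>Fullness keeps the affine image below \<open>1\<close>, so at each step \<open>y\<close>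
  has the same digit as \<open>a\<close> and the distance to the orbit of \<open>a\<close> is
  multiplied by exactly \<open>\<beta>\<close>.\<close>

lemma iterate_cyl:
  assumes "full n a" "y \<in> cyl n a" "i \<le> n"
  shows "(f ^^ i) y = (f ^^ i) a + \<beta> ^ i * (y - a)"
  using assms(3)
proof (induction i)
  case (Suc i)
  let ?b = "(f ^^ i) a"
  have y: "0 \<le> y - a" "y - a < 1 / \<beta> ^ n" using assms(2) by (auto simp: cyl_def)
  have "\<beta> ^ Suc i * (y - a) < \<beta> ^ Suc i * (1 / \<beta> ^ n)"
    using y(2) by (intro mult_strict_left_mono) auto
  moreover have "f ?b + \<beta> ^ Suc i / \<beta> ^ n \<le> 1"
    using assms(1) Suc.prems by (auto simp: full_def dest!: spec[of _ "Suc i"])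
  ultimately have lt: "f ?b + \<beta> ^ Suc i * (y - a) < 1" by simp
  have "f ((f ^^ i) y) = f ?b + \<beta> ^ Suc i * (y - a)"
  proof (rule f_eqI[of _ "\<lfloor>\<beta> * ?b\<rfloor>"])
    show "\<beta> * (f ^^ i) y = of_int \<lfloor>\<beta> * ?b\<rfloor> + (f ?b + \<beta> ^ Suc i * (y - a))"
      using Suc by (simp add: beta_map_def[of _ ?b] frac_def ring_distribs)
    show "0 \<le> f ?b + \<beta> ^ Suc i * (y - a)" using y by (simp add: beta_map_def)
  qed (rule lt)
  then show ?case by simp
qed simp

lemma iterate_cyl_full:
  assumes "full n a" "y \<in> cyl n a"
  shows "(f ^^ n) y = \<beta> ^ n * (y - a)"
  using iterate_cyl[OF assms order_refl] fullD(2)[OF assms(1)] by simp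

lemma cyl_append:
  assumes "full n a" "y \<in> {0..<1}"
  shows "a + y / \<beta> ^ n \<in> cyl n a" "(f ^^ n) (a + y / \<beta> ^ n) = y"
proof -
  show "a + y / \<beta> ^ n \<in> cyl n a" using assms(2) by (auto simp: cyl_def divide_simps)
  from iterate_cyl_full[OF assms(1) this] show "(f ^^ n) (a + y / \<beta> ^ n) = y" by simp
qed

text \<open>Up to time \<open>n\<close> the cylinder of the concatenation lies inside that of
  \<open>a\<close>, because \<open>b + 1 / \<beta> ^ k \<le> 1\<close>; after time \<open>n\<close>
  the conditions are those of \<open>b\<close>.\<close>

lemma full_append:
  assumes "full n a" "full k b"
  shows "full (n + k) (a + b / \<beta> ^ n)"
  unfolding full_def
proof (intro conjI allI impI)
  have b: "b \<in> {0..<1}" using fullD[OF assms(2)] by auto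
  note ap = cyl_append[OF assms(1) b]
  have split: "(f ^^ (n + i)) (a + b / \<beta> ^ n) = (f ^^ i) b" for i
    using ap(2) by (simp add: add.commute[of n] funpow_add)
  show "0 \<le> a + b / \<beta> ^ n" using fullD(1)[OF assms(1)] b by auto
  show "(f ^^ (n + k)) (a + b / \<beta> ^ n) = 0" using split fullD(2)[OF assms(2)] by simp
  fix i assume i: "i \<le> n + k"
  show "(f ^^ i) (a + b / \<beta> ^ n) + \<beta> ^ i / \<beta> ^ (n + k) \<le> 1"
  proof (cases "i \<le> n")
    case True
    have "(f ^^ i) (a + b / \<beta> ^ n) + \<beta> ^ i / \<beta> ^ (n + k)
        = (f ^^ i) a + \<beta> ^ i / \<beta> ^ n * (b + 1 / \<beta> ^ k)"
      using iterate_cyl[OF assms(1) ap(1) True] by (simp add: power_add field_simps)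
    also have "\<dots> \<le> (f ^^ i) a + \<beta> ^ i / \<beta> ^ n * 1"
      using fullD(3)[OF assms(2)] by (intro add_left_mono mult_left_mono) auto
    also have "\<dots> \<le> 1" using assms(1) True by (simp add: full_def)
    finally show ?thesis .
  next
    case False
    then obtain j where j: "i = n + j" "j \<le> k" using i by (metis le_add_diff_inverse nat_le_linear add_le_cancel_left)
    have "(f ^^ j) b + \<beta> ^ j / \<beta> ^ k \<le> 1" using assms(2) j by (simp add: full_def)
    then show ?thesis unfolding j split by (simp add: power_add)
  qed
qed

lemma cyl_append_subset:
  assumes "full n a" "full k b" "y \<in> cyl (n + k) (a + b / \<beta> ^ n)"
  shows "y \<in> cyl n a" "(f ^^ n) y \<in> cyl k b"
proof -
  have y: "a + b / \<beta> ^ n \<le> y" "y < a + (b + 1 / \<beta> ^ k) / \<beta> ^ n"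
    using assms(3) by (auto simp: cyl_def power_add field_simps)
  have "(b + 1 / \<beta> ^ k) / \<beta> ^ n \<le> 1 / \<beta> ^ n"
    using fullD(3)[OF assms(2)] by (intro divide_right_mono) auto
  moreover have "0 \<le> b / \<beta> ^ n" using fullD(1)[OF assms(2)] by simp
  ultimately show *: "y \<in> cyl n a" using y by (auto simp: cyl_def)
  have "b \<le> \<beta> ^ n * (y - a)" "\<beta> ^ n * (y - a) < b + 1 / \<beta> ^ k"
    using y by (simp_all add: field_simps)
  then show "(f ^^ n) y \<in> cyl k b"
    using iterate_cyl_full[OF assms(1) *] by (simp add: cyl_def)
qed

section \<open>Summed orbit distances and approximation by full words\<close>

definition orbit_dist :: "nat \<Rightarrow> real \<Rightarrow> real \<Rightarrow> real" where
  "orbit_dist n x y = (\<Sum>i<n. \<bar>(f ^^ i) x - (f ^^ i) y\<bar>)"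

lemma orbit_dist_Suc: "orbit_dist (Suc n) x y = \<bar>x - y\<bar> + orbit_dist n (f x) (f y)"
  by (simp add: orbit_dist_def sum.lessThan_Suc_shift iterate_Suc del: funpow.simps sum.lessThan_Suc)

text \<open>Distances grow geometrically along a common branch and stay below \<open>1\<close> up to
  time \<open>n\<close>, so their sum is bounded independently of \<open>n\<close>.\<close>

lemma orbit_dist_cyl:
  assumes "full n a" "y \<in> cyl n a" "z \<in> cyl n a"
  shows "orbit_dist n y z \<le> 1 / (\<beta> - 1)"
proof -
  have "orbit_dist n y z = (\<Sum>i<n. \<beta> ^ i * \<bar>y - z\<bar>)"
    unfolding orbit_dist_def
  proof (rule sum.cong)
    fix i assume "i \<in> {..<n}"
    then have "(f ^^ i) y - (f ^^ i) z = \<beta> ^ i * (y - z)"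
      using iterate_cyl[OF assms(1,2), of i] iterate_cyl[OF assms(1,3), of i]
      by (simp add: algebra_simps)
    then show "\<bar>(f ^^ i) y - (f ^^ i) z\<bar> = \<beta> ^ i * \<bar>y - z\<bar>"
      using beta_gt_1 by (simp add: abs_mult)
  qed simp
  also have "\<dots> = (\<beta> ^ n - 1) / (\<beta> - 1) * \<bar>y - z\<bar>"
    using beta_gt_1 by (simp add: sum_distrib_right[symmetric] geometric_sum)
  also have "\<dots> \<le> \<beta> ^ n / (\<beta> - 1) * (1 / \<beta> ^ n)"
    using assms(2,3) beta_gt_1 by (intro mult_mono divide_right_mono) (auto simp: cyl_def)
  finally show ?thesis by simp
qed

text \<open>Lowering the last nonzero digit among the first \<open>n\<close> digits of \<open>x\<close> by one turns its
  cylinder of length \<open>n\<close> into a full one. The terms subtracted from the constants in the bounds on the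
  orbit distance make the induction go through: they absorb the geometric growth along the
  common branch.\<close>

lemma ex_full_near:
  assumes "x \<in> {0..<1}"
  shows "\<exists>a. full n a \<and>
    (a = 0 \<and> x < 1 / \<beta> ^ n \<and> orbit_dist n x a \<le> (1 - x) / (\<beta> - 1) \<or>
     (\<exists>j\<in>{1..n}. a + 1 / \<beta> ^ j \<le> x \<and> x < a + 1 / \<beta> ^ j + 1 / \<beta> ^ n \<and>
        orbit_dist n x a \<le> (3 - (x - a)) / (\<beta> - 1)))"
  using assms
proof (induction n arbitrary: x)
  case 0
  then show ?case using beta_gt_1 by (intro exI[of _ 0]) (auto simp: orbit_dist_def)
next
  case (Suc n)
  from Suc.prems have "0 \<le> x" by simp
  then obtain d where d: "0 \<le> d" "x = (of_int d + f x) / \<beta>" "0 \<le> f x" "f x < 1"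
    "\<beta> * x = of_int d + f x"
    by (rule f_decomp)
  define y where "y = f x"
  have y: "y \<in> {0..<1}" "x = (of_int d + y) / \<beta>"
    unfolding y_def using d(3,4) by (simp, intro d(2))
  from Suc.IH[OF y(1)] obtain a where a: "full n a" and
    cs: "a = 0 \<and> y < 1 / \<beta> ^ n \<and> orbit_dist n y a \<le> (1 - y) / (\<beta> - 1) \<or>
     (\<exists>j\<in>{1..n}. a + 1 / \<beta> ^ j \<le> y \<and> y < a + 1 / \<beta> ^ j + 1 / \<beta> ^ n \<and>
        orbit_dist n y a \<le> (3 - (y - a)) / (\<beta> - 1))" by blast
  \<comment> \<open>In \<open>zero\<close> all digits vanish; in \<open>fresh\<close> the new first
    digit is the only nonzero one and must be lowered; in \<open>old\<close> the digit to be lowered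
    already lies in the tail.\<close>
  from cs consider
      (zero) "a = 0" "y < 1 / \<beta> ^ n" "orbit_dist n y a \<le> (1 - y) / (\<beta> - 1)" "d = 0"
    | (fresh) "a = 0" "y < 1 / \<beta> ^ n" "orbit_dist n y a \<le> (1 - y) / (\<beta> - 1)" "1 \<le> d"
    | (old) j where "j \<in> {1..n}" "a + 1 / \<beta> ^ j \<le> y" "y < a + 1 / \<beta> ^ j + 1 / \<beta> ^ n"
        "orbit_dist n y a \<le> (3 - (y - a)) / (\<beta> - 1)"
    using d(1) by (cases "d = 0") (auto simp: Bex_def)
  then show ?case
  proof cases
    case zero
    have x: "x = y / \<beta>" using y zero by simp
    have "x < 1 / \<beta> ^ Suc n" using zero(2) by (simp add: x field_simps)
    moreover have "orbit_dist (Suc n) x 0 \<le> x + (1 - y) / (\<beta> - 1)"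
      using zero y(1) Suc.prems by (simp add: orbit_dist_Suc flip: y_def)
    moreover have "x + (1 - y) / (\<beta> - 1) = (1 - x) / (\<beta> - 1)"
      using beta_gt_1 by (simp add: x field_simps)
    ultimately show ?thesis by (intro exI[of _ 0]) simp
  next
    case fresh
    \<comment> \<open>The lowered digit \<open>d - 1\<close> followed by zeros; it stands in place
      \<open>1\<close>, hence the witness \<open>j = 1\<close> below.\<close>
    let ?a = "(of_int (d - 1) + 0) / \<beta>"
    have xa: "x - ?a = (1 + y) / \<beta>" "?a + 1 / \<beta> ^ 1 = of_int d / \<beta>"
      unfolding y(2) diff_divide_distrib[symmetric] power_one_right add_divide_distrib[symmetric]
      by simp_all
    have b: "1 / \<beta> ^ Suc n \<le> 1 / \<beta> ^ 1"
      using beta_gt_1 by (intro divide_left_mono power_increasing) auto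
    have dx: "of_int d / \<beta> \<le> x" unfolding y(2) using y(1) by (intro divide_right_mono) auto
    then have a: "full (Suc n) ?a" "f ?a = 0"
      using full_Cons[of n 0 "d - 1"] fresh b xa Suc.prems by auto
    have "y / \<beta> < 1 / \<beta> ^ Suc n" using fresh(2) by (simp add: field_simps)
    then have "x < of_int d / \<beta> + 1 / \<beta> ^ Suc n" by (simp add: y(2) add_divide_distrib)
    moreover have "orbit_dist (Suc n) x ?a \<le> (1 + y) / \<beta> + (1 - y) / (\<beta> - 1)"
      unfolding orbit_dist_Suc a(2) xa using fresh y(1) by (auto simp flip: y_def)
    \<comment> \<open>Multiplied by \<open>\<beta> - 1\<close> and rearranged, this is
      \<open>2 \<le> 3\<close>.\<close>
    moreover have "(1 + y) / \<beta> + (1 - y) / (\<beta> - 1) \<le> (3 - (1 + y) / \<beta>) / (\<beta> - 1)"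
      using beta_gt_1 y(1) by (simp add: field_simps)
    ultimately show ?thesis
      using a(1) dx xa by (intro exI[of _ ?a] conjI disjI2 bexI[of _ 1]) (auto simp del: power_Suc)
  next
    case old
    let ?a = "(of_int d + a) / \<beta>"
    have xa: "x - ?a = (y - a) / \<beta>" by (simp add: y(2) diff_divide_distrib[symmetric])
    have lo: "?a + 1 / \<beta> ^ Suc j \<le> x"
    proof -
      have "(a + 1 / \<beta> ^ j) / \<beta> \<le> y / \<beta>" using old(2) by (intro divide_right_mono) auto
      then show ?thesis by (simp add: y(2) add_divide_distrib mult.commute)
    qed
    have hi: "x < ?a + 1 / \<beta> ^ Suc j + 1 / \<beta> ^ Suc n"
    proof -
      have "y / \<beta> < (a + 1 / \<beta> ^ j + 1 / \<beta> ^ n) / \<beta>"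
        using old(3) by (intro divide_strict_right_mono) auto
      then show ?thesis by (simp add: y(2) add_divide_distrib mult.commute)
    qed
    have "1 / \<beta> ^ Suc n \<le> 1 / \<beta> ^ Suc j"
      using beta_gt_1 old(1) by (intro divide_left_mono power_increasing) auto
    then have a': "full (Suc n) ?a" "f ?a = a"
      using full_Cons[OF a d(1)] lo Suc.prems by auto
    have "0 < 1 / \<beta> ^ j" by simp
    then have "a \<le> y" using old(2) by linarith
    then have "orbit_dist (Suc n) x ?a = (y - a) / \<beta> + orbit_dist n y a"
      unfolding orbit_dist_Suc a'(2) xa by (simp flip: y_def)
    also have "\<dots> \<le> (y - a) / \<beta> + (3 - (y - a)) / (\<beta> - 1)" using old(4) by simp
    also have "\<dots> = (3 - (y - a) / \<beta>) / (\<beta> - 1)" using beta_gt_1 by (simp add: field_simps)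
    finally show ?thesis
      using a' lo hi xa old(1) by (intro exI[of _ ?a] conjI disjI2 bexI[of _ "Suc j"]) auto
  qed
qed

section \<open>Counting full words\<close>

text \<open>The strict inequality excludes cylinders reaching up to \<open>1\<close>; it keeps
  infinite concatenations inside \<open>[0,1)\<close>.\<close>

definition full_words :: "nat \<Rightarrow> real set" where
  "full_words n = {a. full n a \<and> a + 1 / \<beta> ^ n < 1}"

lemma finite_preimages_0: "finite {x \<in> {0..<1}. (f ^^ n) x = 0}"
proof (induction n)
  case 0
  have "{x \<in> {0..<1::real}. (f ^^ 0) x = 0} \<subseteq> {0}" by auto
  then show ?case by (rule finite_subset) simp
next
  case (Suc n)
  let ?P = "{x \<in> {0..<1}. (f ^^ n) x = 0}"
  have "{x \<in> {0..<1}. (f ^^ Suc n) x = 0} \<subseteq> (\<lambda>(d, y). (of_int d + y) / \<beta>) ` ({0..\<lfloor>\<beta>\<rfloor>} \<times> ?P)"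
  proof
    fix x assume x: "x \<in> {x \<in> {0..<1}. (f ^^ Suc n) x = 0}"
    then have "0 \<le> x" by simp
    then obtain d where d: "0 \<le> d" "x = (of_int d + f x) / \<beta>" "0 \<le> f x" "f x < 1"
      "\<beta> * x = of_int d + f x"
      by (rule f_decomp)
    have "of_int d \<le> \<beta> * x" using d(3,5) by simp
    also have "\<dots> \<le> \<beta> * 1" using x by (intro mult_left_mono) auto
    finally have "d \<le> \<lfloor>\<beta>\<rfloor>" by (simp add: le_floor_iff)
    moreover have "f x \<in> ?P" using x d(3,4) by (simp add: iterate_Suc del: funpow.simps)
    ultimately show "x \<in> (\<lambda>(d, y). (of_int d + y) / \<beta>) ` ({0..\<lfloor>\<beta>\<rfloor>} \<times> ?P)"
      using d(1) by (intro image_eqI[of _ _ "(d, f x)"]) (simp_all flip: d(2))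
  qed
  then show ?case by (rule finite_subset) (use Suc in auto)
qed

lemma finite_full_words: "finite (full_words n)"
  by (rule finite_subset[OF _ finite_preimages_0[of n]]) (auto simp: full_words_def dest: fullD)

lemma full_words_append:
  assumes "full n a" "b \<in> full_words k"
  shows "a + b / \<beta> ^ n \<in> full_words (n + k)"
proof -
  have "(b + 1 / \<beta> ^ k) / \<beta> ^ n < 1 / \<beta> ^ n"
    using assms(2) by (intro divide_strict_right_mono) (auto simp: full_words_def)
  moreover have "a + b / \<beta> ^ n + 1 / \<beta> ^ (n + k) = a + (b + 1 / \<beta> ^ k) / \<beta> ^ n"
    by (simp add: add_divide_distrib power_add mult.commute)
  ultimately have "a + b / \<beta> ^ n + 1 / \<beta> ^ (n + k) < 1"
    using fullD(3)[OF assms(1)] by linarith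
  then show ?thesis using full_append[OF assms(1)] assms(2) by (auto simp: full_words_def)
qed

text \<open>The shift \<open>s\<close> is \<open>0\<close> if no digit had to be lowered and
  \<open>1 / \<beta> ^ j\<close> if it was the digit in place \<open>j\<close>. With
  \<open>0 < n\<close> the zero word also has a cylinder ending before \<open>1\<close>.\<close>

lemma ex_full_word_near:
  assumes "x \<in> {0..<1}" "0 < n"
  shows "\<exists>a\<in>full_words n. orbit_dist n x a \<le> 3 / (\<beta> - 1) \<and>
    (\<exists>s\<in>insert 0 ((\<lambda>j. 1 / \<beta> ^ j) ` {1..n}). x \<in> {a + s..<a + s + 1 / \<beta> ^ n})"
proof -
  from ex_full_near[OF assms(1), of n] obtain a where a: "full n a" and
    cs: "a = 0 \<and> x < 1 / \<beta> ^ n \<and> orbit_dist n x a \<le> (1 - x) / (\<beta> - 1) \<or>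
     (\<exists>j\<in>{1..n}. a + 1 / \<beta> ^ j \<le> x \<and> x < a + 1 / \<beta> ^ j + 1 / \<beta> ^ n \<and>
        orbit_dist n x a \<le> (3 - (x - a)) / (\<beta> - 1))" by blast
  from cs show ?thesis
  proof (elim disjE conjE bexE)
    assume z: "a = 0" "x < 1 / \<beta> ^ n" "orbit_dist n x a \<le> (1 - x) / (\<beta> - 1)"
    have "1 / \<beta> ^ n < 1" using beta_gt_1 assms(2) by simp
    then have "a \<in> full_words n" using a z by (simp add: full_words_def)
    moreover have "(1 - x) / (\<beta> - 1) \<le> 3 / (\<beta> - 1)"
      using assms beta_gt_1 by (intro divide_right_mono) auto
    ultimately show ?thesis using z assms by (intro bexI[of _ a]) auto
  next
    fix j assume j: "j \<in> {1..n}" "a + 1 / \<beta> ^ j \<le> x" "x < a + 1 / \<beta> ^ j + 1 / \<beta> ^ n"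
      "orbit_dist n x a \<le> (3 - (x - a)) / (\<beta> - 1)"
    have "1 / \<beta> ^ n \<le> 1 / \<beta> ^ j"
      using beta_gt_1 j(1) by (intro divide_left_mono power_increasing) auto
    then have "a \<in> full_words n" using a j assms by (auto simp: full_words_def)
    moreover have "0 < 1 / \<beta> ^ j" by simp
    then have "a \<le> x" using j(2) by linarith
    then have "(3 - (x - a)) / (\<beta> - 1) \<le> 3 / (\<beta> - 1)"
      using beta_gt_1 by (intro divide_right_mono) auto
    moreover have "a + 0 \<le> x" using j(2) \<open>0 < 1 / \<beta> ^ j\<close> by linarith
    ultimately show ?thesis using j by (intro bexI[of _ a]) auto
  qed
qed

text \<open>The full words of length \<open>n\<close>, together with \<open>n + 1\<close> translates of their cylinders,
  cover the unit interval, so counting them reduces to comparing lengths.\<close>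

lemma card_full_words_ge:
  assumes "0 < n"
  shows "\<beta> ^ n \<le> (real n + 1) * card (full_words n)"
proof -
  let ?S = "insert 0 ((\<lambda>j. 1 / \<beta> ^ j) ` {1..n})"
  let ?I = "full_words n \<times> ?S"
  have fin: "finite ?I" using finite_full_words by simp
  have "1 = measure lborel {0..<1::real}" by simp
  also have "\<dots> \<le> measure lborel (\<Union>(a, s)\<in>?I. {a + s..<a + s + 1 / \<beta> ^ n})"
  proof (rule measure_mono_fmeasurable)
    show "{0..<1} \<subseteq> (\<Union>(a, s)\<in>?I. {a + s..<a + s + 1 / \<beta> ^ n})"
    proof
      fix x :: real assume "x \<in> {0..<1}"
      then obtain a s where "a \<in> full_words n" "s \<in> ?S" "x \<in> {a + s..<a + s + 1 / \<beta> ^ n}"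
        using ex_full_word_near[OF _ assms] by meson
      then show "x \<in> (\<Union>(a, s)\<in>?I. {a + s..<a + s + 1 / \<beta> ^ n})"
        by (intro UN_I[of "(a, s)"]) simp_all
    qed
    show "(\<Union>(a, s)\<in>?I. {a + s..<a + s + 1 / \<beta> ^ n}) \<in> fmeasurable lborel"
      using fin by (intro fmeasurable.finite_UN) (auto simp: fmeasurable_def)
  qed simp
  also have "\<dots> \<le> (\<Sum>(a, s)\<in>?I. measure lborel {a + s..<a + s + 1 / \<beta> ^ n})"
    using measure_UNION_le[OF fin, of "\<lambda>(a, s). {a + s..<a + s + 1 / \<beta> ^ n}" lborel]
    by (auto simp: case_prod_beta)
  also have "\<dots> = card ?I * (1 / \<beta> ^ n)" by (simp add: case_prod_beta)
  also have "\<dots> \<le> (card (full_words n) * (real n + 1)) * (1 / \<beta> ^ n)"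
  proof (intro mult_right_mono)
    have "card ?S \<le> Suc (card ((\<lambda>j. 1 / \<beta> ^ j) ` {1..n}))" by (simp add: card_insert_if)
    also have "\<dots> \<le> n + 1" using card_image_le[of "{1..n}" "\<lambda>j. 1 / \<beta> ^ j"] by simp
    finally have "card ?I \<le> card (full_words n) * (n + 1)"
      unfolding card_cartesian_product by (rule mult_le_mono2)
    from of_nat_mono[OF this, where 'a = real]
    show "real (card ?I) \<le> card (full_words n) * (real n + 1)"
      by (simp only: of_nat_mult of_nat_add of_nat_1)
  qed simp
  finally show ?thesis by (simp add: field_simps)
qed

text \<open>The branches of \<open>f\<close> cut \<open>[0, t)\<close> into
  \<open>\<lfloor>\<beta> * t\<rfloor>\<close> pieces mapped onto the unit interval and a last piece
  mapped onto \<open>[0, frac (\<beta> * t))\<close>; this last piece is why the induction runs over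
  all \<open>t\<close>. The centres are pulled back from covers of the images.\<close>

lemma ex_bowen_cover:
  assumes "0 < \<epsilon>" "t \<in> {0..1}"
  shows "\<exists>C. finite C \<and> C \<subseteq> {0..<t} \<and> card C \<le> (1 / \<epsilon> + n) * \<beta> ^ n * t + 1 \<and>
    (\<forall>y\<in>{0..<t}. \<exists>x\<in>C. \<forall>i\<le>n. dist ((f ^^ i) x) ((f ^^ i) y) < \<epsilon>)"
  using assms(2)
proof (induction n arbitrary: t)
  case 0
  let ?k = "nat \<lceil>t / \<epsilon>\<rceil>"
  let ?C = "(\<lambda>j. of_nat j * \<epsilon>) ` {..<?k}"
  have "?C \<subseteq> {0..<t}"
  proof
    fix x assume "x \<in> ?C"
    then obtain j where j: "x = of_nat j * \<epsilon>" "j < ?k" by blast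
    then have "of_nat j < t / \<epsilon>" by linarith
    then show "x \<in> {0..<t}" using j(1) assms(1) by (auto simp: field_simps)
  qed
  moreover have "real (card ?C) \<le> t / \<epsilon> + 1"
  proof -
    have "card ?C \<le> ?k" using card_image_le[of "{..<?k}" "\<lambda>j. of_nat j * \<epsilon>"] by simp
    moreover have "0 \<le> t / \<epsilon>" using assms(1) 0 by simp
    then have "real ?k \<le> t / \<epsilon> + 1" by linarith
    ultimately show ?thesis by linarith
  qed
  moreover have "\<exists>x\<in>?C. \<forall>i\<le>0. dist ((f ^^ i) x) ((f ^^ i) y) < \<epsilon>" if y: "y \<in> {0..<t}" for y
  proof -
    define j where "j = nat \<lfloor>y / \<epsilon>\<rfloor>"
    have "0 \<le> y / \<epsilon>" "y / \<epsilon> < t / \<epsilon>" using y assms(1) by (auto intro: divide_strict_right_mono)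
    then have j: "real j \<le> y / \<epsilon>" "y / \<epsilon> < real j + 1" "j < ?k" unfolding j_def by linarith+
    then have "real j * \<epsilon> \<le> y" "y < real j * \<epsilon> + \<epsilon>"
      using assms(1) by (simp_all add: field_simps)
    then show ?thesis using j(3) by (intro bexI[of _ "real j * \<epsilon>"]) (auto simp: dist_real_def)
  qed
  ultimately show ?case by (intro exI[of _ ?C]) (auto simp: mult.commute)
next
  case (Suc n)
  define k where "k = \<lfloor>\<beta> * t\<rfloor>"
  define s where "s = frac (\<beta> * t)"
  have k: "0 \<le> k" using Suc.prems by (simp add: k_def)
  have s: "0 \<le> s" "s < 1" "\<beta> * t = k + s" by (simp_all add: s_def k_def frac_lt_1) (simp add: frac_def)
  define G where "G = (1 / \<epsilon> + n) * \<beta> ^ n"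
  obtain C where C: "finite C" "C \<subseteq> {0..<1}" "card C \<le> G * 1 + 1"
    "\<And>y. y \<in> {0..<1} \<Longrightarrow> \<exists>x\<in>C. \<forall>i\<le>n. dist ((f ^^ i) x) ((f ^^ i) y) < \<epsilon>"
    using Suc.IH[of 1] unfolding G_def by auto
  obtain C' where C': "finite C'" "C' \<subseteq> {0..<s}" "card C' \<le> G * s + 1"
    "\<And>y. y \<in> {0..<s} \<Longrightarrow> \<exists>x\<in>C'. \<forall>i\<le>n. dist ((f ^^ i) x) ((f ^^ i) y) < \<epsilon>"
    using Suc.IH[of s] s unfolding G_def by auto
  let ?g = "\<lambda>(j::int, c). (of_int j + c) / \<beta>"
  let ?J = "{0..<k} \<times> C \<union> {k} \<times> C'"
  have J: "fst p \<ge> 0" "snd p \<in> {0..<1}" "of_int (fst p) + snd p < \<beta> * t" if "p \<in> ?J" for p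
  proof -
    obtain j c where p: "p = (j, c)" by force
    have "0 \<le> j \<and> j + 1 \<le> k \<and> c \<in> {0..<1} \<or> j = k \<and> c \<in> {0..<s}"
      using that C(2) C'(2) unfolding p by auto
    then consider "0 \<le> j" "j + 1 \<le> k" "c \<in> {0..<1}" | "j = k" "c \<in> {0..<s}" by blast
    then have "0 \<le> fst p \<and> snd p \<in> {0..<1} \<and> of_int (fst p) + snd p < \<beta> * t"
    proof cases
      case 1
      from 1(2) have "real_of_int j + 1 \<le> real_of_int k"
        by (metis of_int_1 of_int_add of_int_le_iff)
      then show "0 \<le> fst p \<and> snd p \<in> {0..<1} \<and> of_int (fst p) + snd p < \<beta> * t"
        using 1 s p by auto
    qed (use k s p in auto)
    then show "fst p \<ge> 0" "snd p \<in> {0..<1}" "of_int (fst p) + snd p < \<beta> * t" by blast+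
  qed
  have "?g ` ?J \<subseteq> {0..<t}"
  proof (rule image_subsetI)
    fix p assume p: "p \<in> ?J"
    have "0 \<le> (of_int (fst p) + snd p) / \<beta>" using J(1,2)[OF p] by simp
    moreover have "(of_int (fst p) + snd p) / \<beta> < t"
      using J(3)[OF p] by (simp add: pos_divide_less_eq mult.commute)
    ultimately show "?g p \<in> {0..<t}" by (simp add: case_prod_beta)
  qed
  moreover have "real (card (?g ` ?J)) \<le> (1 / \<epsilon> + Suc n) * \<beta> ^ Suc n * t + 1"
  proof -
    have "card (?g ` ?J) \<le> card ?J" using C(1) C'(1) by (intro card_image_le) auto
    also have "\<dots> \<le> nat k * card C + card C'"
      using card_Un_le[of "{0..<k} \<times> C" "{k} \<times> C'"] by (simp add: card_cartesian_product)
    finally have "real (card (?g ` ?J)) \<le> real (nat k * card C + card C')"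
      by (rule of_nat_mono)
    also have "\<dots> = of_int k * real (card C) + real (card C')" using k by simp
    also have "\<dots> \<le> of_int k * (G * 1 + 1) + (G * s + 1)"
      using C(3) C'(3) k by (intro add_mono mult_left_mono) auto
    also have "\<dots> = G * (\<beta> * t) + of_int k + 1" unfolding s(3) by (simp add: algebra_simps)
    \<comment> \<open>Each of the \<open>k\<close> full branches costs one extra centre from
      rounding. Since \<open>k \<le> \<beta> ^ Suc n * t\<close>, this raises the factor
      \<open>1 / \<epsilon> + n\<close> by one.\<close>
    also have "\<dots> \<le> G * (\<beta> * t) + \<beta> ^ Suc n * t + 1"
    proof -
      have "\<beta> ^ 1 * t \<le> \<beta> ^ Suc n * t"
        using Suc.prems beta_gt_1 by (intro mult_right_mono power_increasing) auto
      then show ?thesis using s(1,3) unfolding power_one_right by linarith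
    qed
    finally show ?thesis by (simp add: G_def algebra_simps)
  qed
  moreover have "\<exists>x\<in>?g ` ?J. \<forall>i\<le>Suc n. dist ((f ^^ i) x) ((f ^^ i) y) < \<epsilon>" if y: "y \<in> {0..<t}" for y
  proof -
    have "0 \<le> y" using y by simp
    then obtain d where d: "0 \<le> d" "y = (of_int d + f y) / \<beta>" "0 \<le> f y" "f y < 1"
      "\<beta> * y = of_int d + f y"
      by (rule f_decomp)
    have "\<beta> * y < \<beta> * t" using y by simp
    then have dy: "of_int d + f y < of_int k + s" unfolding s(3) d(5) .
    then have "d \<le> k" using d(3) s(2) by linarith
    then have "\<exists>c. (d, c) \<in> ?J \<and> (\<forall>i\<le>n. dist ((f ^^ i) c) ((f ^^ i) (f y)) < \<epsilon>)"
    proof (cases "d = k")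
      case True
      then show ?thesis using C'(4)[of "f y"] dy d(3) by auto
    next
      case False
      then show ?thesis using C(4)[of "f y"] \<open>d \<le> k\<close> d(1,3,4) by auto
    qed
    then obtain c where c: "(d, c) \<in> ?J" "\<forall>i\<le>n. dist ((f ^^ i) c) ((f ^^ i) (f y)) < \<epsilon>" by blast
    have fc: "f ((of_int d + c) / \<beta>) = c"
      by (rule f_eqI[of _ d]) (use J[OF c(1)] in auto)
    have "dist ((f ^^ i) ((of_int d + c) / \<beta>)) ((f ^^ i) y) < \<epsilon>" if "i \<le> Suc n" for i
    proof (cases i)
      case 0
      have "\<beta> * ((of_int d + c) / \<beta> - y) = c - f y"
        unfolding right_diff_distrib d(5) by simp
      then have "(of_int d + c) / \<beta> - y = (c - f y) / \<beta>"
        by (metis beta_pos(3) nonzero_mult_div_cancel_left)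
      then have "dist ((of_int d + c) / \<beta>) y = \<bar>c - f y\<bar> / \<beta>"
        by (simp add: dist_real_def)
      also have "\<dots> \<le> \<bar>c - f y\<bar> / 1" using beta_gt_1 by (intro divide_left_mono) auto
      also have "\<dots> < \<epsilon>" using c(2)[rule_format, of 0] by (simp add: dist_real_def)
      finally show ?thesis using 0 by simp
    next
      case (Suc j)
      then show ?thesis using c(2) that by (simp add: iterate_Suc fc del: funpow.simps)
    qed
    then show ?thesis using c(1) by (intro bexI[of _ "?g (d, c)"]) auto
  qed
  ultimately show ?case using C(1) C'(1) by (intro exI[of _ "?g ` ?J"]) auto
qed

section \<open>Birkhoff sums of concatenated full words\<close>

definition birkhoff :: "(real \<Rightarrow> real) \<Rightarrow> nat \<Rightarrow> real \<Rightarrow> real" where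
  "birkhoff \<phi> n x = (\<Sum>i<n. \<phi> ((f ^^ i) x))"

lemma birkhoff_add: "birkhoff \<phi> (n + k) x = birkhoff \<phi> n x + birkhoff \<phi> k ((f ^^ n) x)"
proof (induction k)
  case (Suc k)
  have "(f ^^ (n + k)) x = (f ^^ k) ((f ^^ n) x)" by (simp add: add.commute[of n] funpow_add)
  with Suc show ?case by (simp add: birkhoff_def)
qed (simp add: birkhoff_def)

lemma birkhoff_uminus: "birkhoff (\<lambda>x. - \<phi> x) n x = - birkhoff \<phi> n x"
  by (simp add: birkhoff_def sum_negf)

lemma birkhoff_diff_le:
  assumes \<phi>: "\<And>u v. u \<in> {0..1} \<Longrightarrow> v \<in> {0..1} \<Longrightarrow> \<bar>\<phi> u - \<phi> v\<bar> \<le> \<eta> + K * dist u v"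
    and xy: "x \<in> {0..<1}" "y \<in> {0..<1}" and "0 \<le> K" "orbit_dist n x y \<le> d"
  shows "\<bar>birkhoff \<phi> n x - birkhoff \<phi> n y\<bar> \<le> real n * \<eta> + K * d"
proof -
  have "\<bar>birkhoff \<phi> n x - birkhoff \<phi> n y\<bar> \<le> (\<Sum>i<n. \<bar>\<phi> ((f ^^ i) x) - \<phi> ((f ^^ i) y)\<bar>)"
    unfolding birkhoff_def sum_subtractf[symmetric] by (rule sum_abs)
  also have "\<dots> \<le> (\<Sum>i<n. \<eta> + K * \<bar>(f ^^ i) x - (f ^^ i) y\<bar>)"
  proof (rule sum_mono)
    fix i
    show "\<bar>\<phi> ((f ^^ i) x) - \<phi> ((f ^^ i) y)\<bar> \<le> \<eta> + K * \<bar>(f ^^ i) x - (f ^^ i) y\<bar>"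
      using \<phi>[of "(f ^^ i) x" "(f ^^ i) y"] iterate_in_unit[OF xy(1), of i] iterate_in_unit[OF xy(2), of i]
      by (simp add: dist_real_def)
  qed
  also have "\<dots> = real n * \<eta> + K * orbit_dist n x y"
    by (simp add: sum.distrib sum_distrib_left orbit_dist_def)
  also have "\<dots> \<le> real n * \<eta> + K * d" using assms by (intro add_left_mono mult_left_mono)
  finally show ?thesis .
qed

lemma birkhoff_bounded:
  assumes "continuous_on {0..1} \<phi>"
  obtains M where "\<And>x n. x \<in> {0..<1} \<Longrightarrow> \<bar>birkhoff \<phi> n x\<bar> \<le> real n * M"
proof -
  obtain M where "\<forall>y\<in>\<phi> ` {0..1}. norm y \<le> M"
    using compact_imp_bounded[OF compact_continuous_image[OF assms compact_Icc]]
    unfolding bounded_iff by blast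
  then have M: "\<bar>\<phi> x\<bar> \<le> M" if "x \<in> {0..<1}" for x using that by auto
  have "\<bar>birkhoff \<phi> n x\<bar> \<le> real n * M" if "x \<in> {0..<1}" for n x
  proof -
    have "\<bar>birkhoff \<phi> n x\<bar> \<le> (\<Sum>i<n. \<bar>\<phi> ((f ^^ i) x)\<bar>)" unfolding birkhoff_def by (rule sum_abs)
    also have "\<dots> \<le> (\<Sum>i<n. M)" by (intro sum_mono M iterate_in_unit that)
    finally show ?thesis by simp
  qed
  then show thesis using that by blast
qed

text \<open>At a late time with average below \<open>a\<close>, the orbit of \<open>x\<close> is
  replaced by a nearby full word. This replacement and the variation over its cylinder change the
  Birkhoff sum by a small multiple of \<open>n\<close> plus a constant, together less than the gap
  \<open>(b - a) * n\<close> allows.\<close>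

lemma ex_full_word_birkhoff_le:
  assumes cont: "continuous_on {0..1} \<phi>" and x: "x \<in> {0..<1}" and ab: "a < b"
    and freq: "\<exists>\<^sub>F n in sequentially. birkhoff \<phi> n x / real n < a"
  obtains n w where "0 < n" "w \<in> full_words n" "\<And>y. y \<in> cyl n w \<Longrightarrow> birkhoff \<phi> n y \<le> b * real n"
proof -
  let ?c = "1 / (\<beta> - 1)"
  obtain K where K: "0 \<le> K"
    "\<And>u v. u \<in> {0..1} \<Longrightarrow> v \<in> {0..1} \<Longrightarrow> \<bar>\<phi> u - \<phi> v\<bar> \<le> (b - a) / 4 + K * dist u v"
    by (rule compact_modulus_of_continuity[OF compact_Icc cont, of "(b - a) / 4"]) (use ab in auto)
  \<comment> \<open>The two comparisons below cost \<open>4 * K * ?c\<close> in all besides twice a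
    quarter of \<open>(b - a) * n\<close>; beyond \<open>N\<close> the constant part takes at most
    the remaining half.\<close>
  obtain N :: nat where N: "8 * K * ?c / (b - a) \<le> real N" using real_arch_simple by blast
  obtain n where n: "n > N" "birkhoff \<phi> n x / real n < a"
    using freq unfolding frequently_sequentially by (meson Suc_le_eq)
  then have n0: "0 < n" by simp
  then have bx: "birkhoff \<phi> n x \<le> a * real n" using n(2) by (simp add: pos_divide_less_eq)
  obtain w where w: "w \<in> full_words n" "orbit_dist n x w \<le> 3 / (\<beta> - 1)"
    using ex_full_word_near[OF x n0] by blast
  then have fw: "full n w" by (simp add: full_words_def)
  have w01: "w \<in> {0..<1}" using fullD[OF fw] by auto
  show thesis
  proof (rule that[OF n0 w(1)])
    fix y assume y: "y \<in> cyl n w"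
    have y01: "y \<in> {0..<1}" using cyl_subset[OF fw] y by blast
    define L where "L = K * ?c"
    define \<Delta> where "\<Delta> = (b - a) * real n"
    have "\<bar>birkhoff \<phi> n x - birkhoff \<phi> n w\<bar> \<le> \<Delta> / 4 + 3 * L"
      using birkhoff_diff_le[OF K(2) x w01 K(1) w(2)] by (simp add: L_def \<Delta>_def mult.commute)
    moreover have "\<bar>birkhoff \<phi> n w - birkhoff \<phi> n y\<bar> \<le> \<Delta> / 4 + L"
      using birkhoff_diff_le[OF K(2) w01 y01 K(1) orbit_dist_cyl[OF fw fullD(5)[OF fw] y]]
      by (simp add: L_def \<Delta>_def mult.commute)
    moreover have "8 * L \<le> (b - a) * real N"
      using iffD1[OF pos_divide_le_eq N] ab by (simp add: L_def mult.commute)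
    moreover have "(b - a) * real N \<le> \<Delta>"
      unfolding \<Delta>_def using n(1) ab by (intro mult_left_mono) auto
    ultimately have "birkhoff \<phi> n y \<le> a * real n + \<Delta>" using bx by linarith
    then show "birkhoff \<phi> n y \<le> b * real n" by (simp add: \<Delta>_def algebra_simps)
  qed
qed

text \<open>Since the bound holds on the whole cylinder, it adds up over repetitions without error.
  Repetition later brings two words to a common, large length.\<close>

lemma ex_full_word_repeat:
  assumes w: "w \<in> full_words n" "\<And>y. y \<in> cyl n w \<Longrightarrow> birkhoff \<phi> n y \<le> b * real n" and "0 < r"
  obtains v where "v \<in> full_words (r * n)"
    "\<And>y. y \<in> cyl (r * n) v \<Longrightarrow> birkhoff \<phi> (r * n) y \<le> b * real (r * n)"
proof -
  have "\<exists>v\<in>full_words (r * n). \<forall>y\<in>cyl (r * n) v. birkhoff \<phi> (r * n) y \<le> b * real (r * n)"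
    using assms(3)
  proof (induction r rule: nat_induct_non_zero)
    case 1
    then show ?case using w by auto
  next
    case (Suc r)
    then obtain v where v: "v \<in> full_words (r * n)"
      "\<And>y. y \<in> cyl (r * n) v \<Longrightarrow> birkhoff \<phi> (r * n) y \<le> b * real (r * n)" by blast
    have full: "full n w" "full (r * n) v" using w v by (auto simp: full_words_def)
    have "birkhoff \<phi> (n + r * n) y \<le> b * real (n + r * n)"
      if "y \<in> cyl (n + r * n) (w + v / \<beta> ^ n)" for y
      using w(2)[OF cyl_append_subset(1)[OF full that]] v(2)[OF cyl_append_subset(2)[OF full that]]
      by (simp add: birkhoff_add algebra_simps)
    then show ?case using full_words_append[OF full(1) v(1)] by auto
  qed
  then show thesis using that by blast
qed

section \<open>Points coded by sequences of full words\<close>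

definition coded_point :: "nat \<Rightarrow> (nat \<Rightarrow> real) \<Rightarrow> real" where
  "coded_point T w = (\<Sum>k. w k / (\<beta> ^ T) ^ k)"

text \<open>Each word is at most \<open>1 - 1 / \<beta> ^ T\<close>, so a geometric series of sum
  \<open>1\<close> dominates. Peeling off the first term leaves the coded point of the shifted
  sequence divided by \<open>\<beta> ^ T\<close>, to which \<open>cyl_append\<close>
  applies.\<close>

lemma coded_point:
  assumes T: "0 < T" and w: "\<And>k. w k \<in> full_words T"
  shows "coded_point T w \<in> cyl T (w 0)" "coded_point T w \<in> {0..<1}"
    "(f ^^ T) (coded_point T w) = coded_point T (\<lambda>k. w (Suc k))"
proof -
  define q where "q = \<beta> ^ T"
  have q: "1 < q" using beta_gt_1 T by (simp add: q_def)
  have full: "full T (w k)" for k using w by (auto simp: full_words_def)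
  have w01: "0 \<le> w k" "w k \<le> 1 - 1 / q" for k
    using fullD[OF full[of k]] by (auto simp: q_def)
  have geo: "(\<lambda>k. (1 - 1 / q) * (1 / q) ^ k) sums 1"
    using sums_mult[OF geometric_sums[of "1 / q"], of "1 - 1 / q"] q by simp
  have le: "v k / q ^ k \<le> (1 - 1 / q) * (1 / q) ^ k" if "\<And>k. v k \<le> 1 - 1 / q" for v k
  proof -
    have "v k / q ^ k \<le> (1 - 1 / q) / q ^ k" using q that by (intro divide_right_mono) auto
    then show ?thesis by (simp add: power_one_over)
  qed
  have summ: "summable (\<lambda>k. v k / q ^ k)" if v: "\<And>k. 0 \<le> v k" "\<And>k. v k \<le> 1 - 1 / q" for v
    using v q le[OF v(2)] by (intro summable_comparison_test'[OF sums_summable[OF geo]]) auto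
  have bd: "0 \<le> (\<Sum>k. v k / q ^ k)" "(\<Sum>k. v k / q ^ k) \<le> 1"
    if v: "\<And>k. 0 \<le> v k" "\<And>k. v k \<le> 1 - 1 / q" for v
  proof -
    show "0 \<le> (\<Sum>k. v k / q ^ k)" using v q by (intro suminf_nonneg summ) auto
    show "(\<Sum>k. v k / q ^ k) \<le> 1"
      using suminf_le[OF le[OF v(2)] summ[OF v] sums_summable[OF geo]] sums_unique[OF geo] by simp
  qed
  have step: "coded_point T v = v 0 + coded_point T (\<lambda>k. v (Suc k)) / q"
    if v: "\<And>k. 0 \<le> v k" "\<And>k. v k \<le> 1 - 1 / q" for v
  proof -
    have "(\<Sum>k. v (Suc k) / q ^ k) / q = (\<Sum>k. v (Suc k) / q ^ k / q)"
      by (intro suminf_divide[symmetric] summ v)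
    also have "\<dots> = (\<Sum>k. v (Suc k) / q ^ Suc k)" by (simp add: mult.commute)
    also have "\<dots> = (\<Sum>k. v k / q ^ k) - v 0"
      using suminf_split_head[OF summ[OF v]] by simp
    finally show ?thesis by (simp add: coded_point_def q_def)
  qed
  \<comment> \<open>The geometric majorant gives only \<open>\<le> 1\<close>; strictness comes from
    the leading word, whose cylinder stops short of \<open>1\<close>.\<close>
  have lt1: "coded_point T (\<lambda>k. w (k + j)) < 1" for j
  proof -
    have "coded_point T (\<lambda>k. w (Suc k + j)) / q \<le> 1 / q"
      using bd(2)[of "\<lambda>k. w (Suc k + j)"] w01 q
      by (intro divide_right_mono) (auto simp: coded_point_def simp flip: q_def)
    moreover have "w j + 1 / q < 1" using w[of j] by (auto simp: full_words_def q_def)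
    ultimately show ?thesis using step[of "\<lambda>k. w (k + j)"] w01 by simp
  qed
  have ge0: "0 \<le> coded_point T (\<lambda>k. w (k + j))" for j
    using bd(1)[of "\<lambda>k. w (k + j)"] w01 by (simp add: coded_point_def flip: q_def)
  show "coded_point T w \<in> {0..<1}" using lt1[of 0] ge0[of 0] by simp
  have eq: "coded_point T w = w 0 + coded_point T (\<lambda>k. w (Suc k)) / \<beta> ^ T"
    using step[of w] w01 by (simp add: q_def)
  have shift: "coded_point T (\<lambda>k. w (Suc k)) \<in> {0..<1}" using lt1[of 1] ge0[of 1] by simp
  show "coded_point T w \<in> cyl T (w 0)" "(f ^^ T) (coded_point T w) = coded_point T (\<lambda>k. w (Suc k))"
    unfolding eq using cyl_append[OF full shift] by auto
qed

lemma coded_point_shift: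
  assumes T: "0 < T" and w: "\<And>k. w k \<in> full_words T"
  shows "(f ^^ (k * T)) (coded_point T w) = coded_point T (\<lambda>i. w (i + k))"
    "coded_point T (\<lambda>i. w (i + k)) \<in> cyl T (w k)"
proof -
  show "(f ^^ (k * T)) (coded_point T w) = coded_point T (\<lambda>i. w (i + k))"
  proof (induction k)
    case (Suc k)
    have "(f ^^ (Suc k * T)) (coded_point T w) = (f ^^ T) (coded_point T (\<lambda>i. w (i + k)))"
      using Suc by (simp add: funpow_add)
    also have "\<dots> = coded_point T (\<lambda>i. w (i + Suc k))"
      using coded_point(3)[OF T, of "\<lambda>i. w (i + k)"] w by simp
    finally show ?case .
  qed simp
  show "coded_point T (\<lambda>i. w (i + k)) \<in> cyl T (w k)"
    using coded_point(1)[OF T, of "\<lambda>i. w (i + k)"] w by simp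
qed

lemma birkhoff_coded_point:
  assumes "0 < T" "\<And>k. w k \<in> full_words T"
  shows "birkhoff \<phi> (n * T) (coded_point T w) = (\<Sum>k<n. birkhoff \<phi> T (coded_point T (\<lambda>i. w (i + k))))"
proof (induction n)
  case (Suc n)
  have "birkhoff \<phi> (Suc n * T) (coded_point T w) = birkhoff \<phi> (n * T + T) (coded_point T w)"
    by (simp add: add.commute)
  then show ?case unfolding birkhoff_add coded_point_shift(1)[OF assms] using Suc by simp
qed (simp add: birkhoff_def)

text \<open>If both the constant pattern of \<open>A\<close>-blocks and the oscillating pattern of \<open>A\<close>- and
  \<open>B\<close>-blocks had convergent averages, so would the difference of their Birkhoff sums, which is
  small along \<open>A\<close>-stages and large along \<open>B\<close>-stages.\<close>

lemma ex_irregular_coded_point: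
  assumes cont: "continuous_on {0..1} \<phi>" and T: "0 < T"
    and A: "\<And>k. A k \<in> full_words T" and B: "\<And>k. B k \<in> full_words T" and eg: "e < g"
    and AA: "\<And>k y z. y \<in> cyl T (A k) \<Longrightarrow> z \<in> cyl T (A k) \<Longrightarrow> birkhoff \<phi> T z - birkhoff \<phi> T y \<le> e"
    and AB: "\<And>k y z. y \<in> cyl T (A k) \<Longrightarrow> z \<in> cyl T (B k) \<Longrightarrow> g \<le> birkhoff \<phi> T z - birkhoff \<phi> T y"
  shows "\<exists>w. (\<forall>k. w k \<in> {A k, B k}) \<and> coded_point T w \<in> irregular_set {0..<1} f \<phi>"
proof (rule ccontr)
  assume none: "\<not> ?thesis"
  obtain P where P: "\<And>d e g M. e < g \<Longrightarrow> (\<And>i. \<bar>d i\<bar> \<le> (M :: real)) \<Longrightarrow> (\<And>i. \<not> P i \<Longrightarrow> d i \<le> e) \<Longrightarrow>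
      (\<And>i :: nat. P i \<Longrightarrow> g \<le> d i) \<Longrightarrow> \<not> convergent (\<lambda>n. (\<Sum>i<n. d i) / real n)"
    using ex_oscillating_pattern by blast
  define w where "w = (\<lambda>k. if P k then B k else A k)"
  have w: "w k \<in> full_words T" for k using A B by (simp add: w_def)
  have conv: "convergent (\<lambda>n. birkhoff \<phi> (n * T) (coded_point T v) / real (n * T))"
    if v: "\<And>k. v k \<in> {A k, B k}" for v
  proof -
    have "v k \<in> full_words T" for k using v[of k] A[of k] B[of k] by auto
    then have "coded_point T v \<in> {0..<1}" by (rule coded_point(2)[OF T])
    moreover have "coded_point T v \<notin> irregular_set {0..<1} f \<phi>" using none v by blast
    ultimately have "convergent (\<lambda>n. birkhoff \<phi> n (coded_point T v) / real n)"
      by (simp add: irregular_set_def birkhoff_def)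
    from convergent_subseq_convergent[OF this, of "\<lambda>n. n * T"] show ?thesis
      using T by (simp add: strict_mono_def o_def)
  qed
  define d where "d = (\<lambda>k. birkhoff \<phi> T (coded_point T (\<lambda>i. w (i + k))) - birkhoff \<phi> T (coded_point T (\<lambda>i. A (i + k))))"
  \<comment> \<open>The factor \<open>T\<close> turns averages per unit of time into averages per
    block.\<close>
  have "convergent (\<lambda>n. real T * (birkhoff \<phi> (n * T) (coded_point T w) / real (n * T)
      - birkhoff \<phi> (n * T) (coded_point T A) / real (n * T)))"
    by (intro convergent_mult convergent_const convergent_diff conv) (auto simp: w_def)
  moreover have "real T * (birkhoff \<phi> (n * T) (coded_point T w) / real (n * T)
      - birkhoff \<phi> (n * T) (coded_point T A) / real (n * T)) = (\<Sum>k<n. d k) / real n" for n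
    unfolding d_def birkhoff_coded_point[where w = w, OF T w] birkhoff_coded_point[where w = A, OF T A]
      sum_subtractf diff_divide_distrib[symmetric] using T by simp
  ultimately have "convergent (\<lambda>n. (\<Sum>k<n. d k) / real n)" by simp
  moreover obtain M where bd: "\<And>x n. x \<in> {0..<1} \<Longrightarrow> \<bar>birkhoff \<phi> n x\<bar> \<le> real n * M"
    using birkhoff_bounded[OF cont] by blast
  have "\<not> convergent (\<lambda>n. (\<Sum>k<n. d k) / real n)"
  proof (rule P[OF eg, where M = "2 * (real T * M)"])
    fix k
    have "\<bar>birkhoff \<phi> T (coded_point T (\<lambda>i. w (i + k)))\<bar> \<le> real T * M"
      "\<bar>birkhoff \<phi> T (coded_point T (\<lambda>i. A (i + k)))\<bar> \<le> real T * M"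
      by (rule bd[OF coded_point(2)[OF T]], rule w A)+
    then show "\<bar>d k\<bar> \<le> 2 * (real T * M)" unfolding d_def by linarith
    note cA = coded_point_shift(2)[where w = A and k = k, OF T A]
    note cw = coded_point_shift(2)[where w = w and k = k, OF T w]
    show "d k \<le> e" if "\<not> P k" unfolding d_def using AA[OF cA] cw that by (simp add: w_def)
    show "g \<le> d k" if "P k" unfolding d_def using AB[OF cA] cw that by (simp add: w_def)
  qed
  ultimately show False by blast
qed

section \<open>Entropy\<close>

text \<open>Two orbits in the same Bowen ball stay within \<open>2 * \<epsilon>\<close> of each
  other. The difference \<open>m\<close> of their digits is an integer of modulus below
  \<open>2 * \<epsilon> * (1 + \<beta>) \<le> 1\<close>, hence zero, so a discontinuity never
  separates the two branches.\<close>

lemma bowen_ball_same_branch: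
  assumes \<epsilon>: "\<epsilon> \<le> 1 / (2 * (1 + \<beta>))"
    and yz: "y \<in> bowen_ball {0..<1} f n x \<epsilon>" "z \<in> bowen_ball {0..<1} f n x \<epsilon>" and "i < n"
  shows "(f ^^ i) y - (f ^^ i) z = \<beta> ^ i * (y - z)"
  using \<open>i < n\<close>
proof (induction i)
  case (Suc i)
  have close: "\<bar>(f ^^ j) y - (f ^^ j) z\<bar> < 2 * \<epsilon>" if "j < n" for j
  proof -
    have "dist ((f ^^ j) x) ((f ^^ j) y) < \<epsilon>" "dist ((f ^^ j) x) ((f ^^ j) z) < \<epsilon>"
      using yz that by (auto simp: bowen_ball_def)
    then show ?thesis unfolding dist_real_def by linarith
  qed
  let ?y = "(f ^^ i) y" and ?z = "(f ^^ i) z"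
  define m where "m = \<lfloor>\<beta> * ?y\<rfloor> - \<lfloor>\<beta> * ?z\<rfloor>"
  have m: "f ?y - f ?z = \<beta> * (?y - ?z) - of_int m"
    by (simp add: beta_map_def[of \<beta> ?y] beta_map_def[of \<beta> ?z] frac_def m_def right_diff_distrib)
  have "\<bar>\<beta> * (?y - ?z)\<bar> < \<beta> * (2 * \<epsilon>)"
    using close[of i] Suc.prems by (simp add: abs_mult)
  moreover have "\<bar>f ?y - f ?z\<bar> < 2 * \<epsilon>" using close[OF Suc.prems] by simp
  ultimately have "\<bar>of_int m\<bar> < \<beta> * (2 * \<epsilon>) + 2 * \<epsilon>" using m by linarith
  also have "\<dots> = \<epsilon> * (2 * (1 + \<beta>))" by (simp add: algebra_simps)
  also have "\<dots> \<le> 1"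
    using \<epsilon> beta_gt_1 by (subst (asm) pos_le_divide_eq) auto
  finally have "m = 0" by linarith
  then show ?case using m Suc by simp
qed simp

lemma full_cyl_unique:
  assumes "full n a" "full n b" "y \<in> cyl n a" "z \<in> cyl n b" "(f ^^ n) y - (f ^^ n) z = \<beta> ^ n * (y - z)"
  shows "a = b"
proof -
  have "\<beta> ^ n * (y - a) - \<beta> ^ n * (z - b) = \<beta> ^ n * (y - z)"
    using assms(5) iterate_cyl_full[OF assms(1,3)] iterate_cyl_full[OF assms(2,4)] by simp
  then have "\<beta> ^ n * (b - a) = 0" by (simp add: algebra_simps)
  then show ?thesis by simp
qed

text \<open>A Bowen ball of length \<open>n\<close> determines the first \<open>n div T\<close>
  letters of every \<open>u\<close> whose point it contains, so its mass is at most
  \<open>1 / card U ^ (n div T)\<close>. For \<open>\<alpha> < h\<close> every cover therefore costs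
  at least \<open>1 / card U\<close>.\<close>

lemma h_top_eps_ge:
  fixes pt :: "(nat \<Rightarrow> real) \<Rightarrow> real"
  assumes U: "finite U" "U \<noteq> {}" "\<And>a. a \<in> U \<Longrightarrow> full m a" and m: "m < T"
    and pt: "\<And>u. \<forall>k. u k \<in> U \<Longrightarrow> pt u \<in> Z"
    and cyl: "\<And>u k. \<forall>k. u k \<in> U \<Longrightarrow> (f ^^ (k * T)) (pt u) \<in> cyl m (u k)"
    and h: "0 \<le> h" "exp (h * real T) \<le> real (card U)"
    and \<epsilon>: "\<epsilon> \<le> 1 / (2 * (1 + \<beta>))"
  shows "ereal h \<le> h_top_eps {0..<1} f Z \<epsilon>"
  unfolding h_top_eps_def
proof (rule Inf_greatest)
  fix a assume "a \<in> {ereal \<alpha> |\<alpha>. ent_m {0..<1} f Z \<alpha> \<epsilon> = 0}"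
  then obtain \<alpha> where \<alpha>: "a = ereal \<alpha>" "ent_m {0..<1} f Z \<alpha> \<epsilon> = 0" by blast
  show "ereal h \<le> a"
  proof (rule ccontr)
    assume "\<not> ?thesis"
    then have ah: "\<alpha> < h" using \<alpha> by simp
    let ?G = "real (card U)"
    have G: "0 < ?G" using U by (simp add: card_gt_0_iff)
    have "ennreal (1 / ?G) \<le> ent_M {0..<1} f Z \<alpha> \<epsilon> 0"
      unfolding ent_M_def
    proof (rule Inf_greatest)
      fix s assume "s \<in> {(\<Sum>\<^sub>\<infinity>i\<in>I. ennreal (exp (- \<alpha> * real (n i)))) | (I :: nat set) x n.
            (\<forall>i\<in>I. x i \<in> {0..<1} \<and> 0 \<le> n i) \<and> Z \<subseteq> (\<Union>i\<in>I. bowen_ball {0..<1} f (n i) (x i) \<epsilon>)}"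
      then obtain I :: "nat set" and x n where
        s: "s = (\<Sum>\<^sub>\<infinity>i\<in>I. ennreal (exp (- \<alpha> * real (n i))))"
        and Z: "Z \<subseteq> (\<Union>i\<in>I. bowen_ball {0..<1} f (n i) (x i) \<epsilon>)" by blast
      define C where "C = (\<lambda>i. {u. (\<forall>k. u k \<in> U) \<and> pt u \<in> bowen_ball {0..<1} f (n i) (x i) \<epsilon>})"
      have "1 \<le> (\<Sum>\<^sub>\<infinity>i\<in>I. ennreal (1 / ?G ^ (n i div T)))"
      proof (rule sequence_cover_mass[OF U(1,2), where C = C])
        fix u :: "nat \<Rightarrow> real" assume "\<forall>k. u k \<in> U"
        then show "\<exists>i\<in>I. u \<in> C i" using pt[of u] Z by (auto simp: C_def)
      next
        fix i k and u v :: "nat \<Rightarrow> real"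
        assume i: "i \<in> I" "u \<in> C i" "v \<in> C i" and k: "k < n i div T"
        have u: "\<forall>k. u k \<in> U" "pt u \<in> bowen_ball {0..<1} f (n i) (x i) \<epsilon>"
          and v: "\<forall>k. v k \<in> U" "pt v \<in> bowen_ball {0..<1} f (n i) (x i) \<epsilon>"
          using i by (auto simp: C_def)
        \<comment> \<open>Because \<open>m < T\<close>, the time \<open>k * T + m\<close> at which
          the word \<open>u k\<close> is completed is still seen by the ball.\<close>
        have "(k + 1) * T \<le> n i div T * T" using k by (intro mult_le_mono1) simp
        also have "\<dots> \<le> n i" by simp
        finally have lt: "k * T + m < n i" "k * T < n i" using m by (simp_all add: algebra_simps)
        note lin = bowen_ball_same_branch[OF \<epsilon> u(2) v(2)]
        have it: "(f ^^ m) ((f ^^ (k * T)) y) = (f ^^ (k * T + m)) y" for y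
          by (simp add: add.commute[of "k * T"] funpow_add)
        have "(f ^^ m) ((f ^^ (k * T)) (pt u)) - (f ^^ m) ((f ^^ (k * T)) (pt v))
            = \<beta> ^ m * ((f ^^ (k * T)) (pt u) - (f ^^ (k * T)) (pt v))"
          unfolding it lin[OF lt(1)] lin[OF lt(2)] by (simp add: power_add)
        then show "u k = v k"
          by (intro full_cyl_unique[OF U(3) U(3) cyl[OF u(1)] cyl[OF v(1)]]) (use u v in auto)
      qed
      \<comment> \<open>The extra factor \<open>1 / ?G\<close> pays for rounding down in
        \<open>n i div T\<close>.\<close>
      then have "ennreal (1 / ?G) * 1 \<le> ennreal (1 / ?G) * (\<Sum>\<^sub>\<infinity>i\<in>I. ennreal (1 / ?G ^ (n i div T)))"
        by (rule mult_left_mono) simp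
      also have "\<dots> = (\<Sum>\<^sub>\<infinity>i\<in>I. ennreal (1 / ?G) * ennreal (1 / ?G ^ (n i div T)))"
        by (simp add: nonneg_infsum_complete SUP_mult_left_ennreal sum_distrib_left del: sum_ennreal)
      also have "\<dots> \<le> s"
        unfolding s
      proof (rule infsum_mono)
        fix i
        have "n i < T * Suc (n i div T)"
          unfolding mult_Suc_right by (rule dividend_less_times_div) (use m in simp)
        then have "real (n i) \<le> real T * real (Suc (n i div T))"
          by (metis less_imp_le of_nat_le_iff of_nat_mult)
        then have "h * real (n i) \<le> h * (real T * real (Suc (n i div T)))"
          using h(1) by (rule mult_left_mono)
        moreover have "\<alpha> * real (n i) \<le> h * real (n i)" using ah by (intro mult_right_mono) auto
        ultimately have "\<alpha> * real (n i) \<le> real (Suc (n i div T)) * (h * real T)"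
          by (simp only: mult_ac)
        then have "exp (\<alpha> * real (n i)) \<le> exp (h * real T) ^ Suc (n i div T)"
          by (simp only: exp_of_nat_mult[symmetric] exp_le_cancel_iff)
        also have "\<dots> \<le> ?G ^ Suc (n i div T)" by (rule power_mono[OF h(2)]) simp
        finally have "1 / ?G ^ Suc (n i div T) \<le> 1 / exp (\<alpha> * real (n i))"
          using G by (intro divide_left_mono) auto
        then show "ennreal (1 / ?G) * ennreal (1 / ?G ^ (n i div T)) \<le> ennreal (exp (- \<alpha> * real (n i)))"
          by (simp add: ennreal_mult'[symmetric] exp_minus inverse_eq_divide ennreal_leI)
      qed (auto intro: nonneg_summable_on_complete)
      finally show "ennreal (1 / ?G) \<le> s" by simp
    qed
    also have "\<dots> \<le> ent_m {0..<1} f Z \<alpha> \<epsilon>" unfolding ent_m_eq_SUP by (rule SUP_upper) simp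
    finally show False using \<alpha>(2) G by simp
  qed
qed

section \<open>The upper bound for the entropy\<close>

lemma ent_M_le:
  assumes "0 < \<epsilon>" "Z \<subseteq> {0..<1}"
  shows "ent_M {0..<1} f Z \<alpha> \<epsilon> (Suc n)
    \<le> ennreal (((1 / \<epsilon> + real n) * \<beta> ^ n + 1) * exp (- \<alpha> * real (Suc n)))"
proof -
  obtain C where C: "finite C" "C \<subseteq> {0..<1}" "card C \<le> (1 / \<epsilon> + real n) * \<beta> ^ n * 1 + 1"
    "\<And>y. y \<in> {0..<1} \<Longrightarrow> \<exists>x\<in>C. \<forall>i\<le>n. dist ((f ^^ i) x) ((f ^^ i) y) < \<epsilon>"
    using ex_bowen_cover[OF assms(1), of 1 n] by auto
  obtain c where c: "bij_betw c {0..<card C} C" using ex_bij_betw_nat_finite[OF C(1)] by blast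
  let ?I = "{0..<card C}"
  have "ent_M {0..<1} f Z \<alpha> \<epsilon> (Suc n) \<le> (\<Sum>\<^sub>\<infinity>i\<in>?I. ennreal (exp (- \<alpha> * real (Suc n))))"
    unfolding ent_M_def
  proof (rule Inf_lower, rule CollectI, intro exI conjI)
    show "(\<Sum>\<^sub>\<infinity>i\<in>?I. ennreal (exp (- \<alpha> * real (Suc n))))
      = (\<Sum>\<^sub>\<infinity>i\<in>?I. ennreal (exp (- \<alpha> * real ((\<lambda>_. Suc n) i))))" by simp
    show "\<forall>i\<in>?I. c i \<in> {0..<1} \<and> Suc n \<le> Suc n" using C(2) bij_betwE[OF c] by blast
    show "Z \<subseteq> (\<Union>i\<in>?I. bowen_ball {0..<1} f (Suc n) (c i) \<epsilon>)"
    proof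
      fix y assume "y \<in> Z"
      then have y: "y \<in> {0..<1}" using assms(2) by blast
      then obtain x where x: "x \<in> C" "\<forall>i\<le>n. dist ((f ^^ i) x) ((f ^^ i) y) < \<epsilon>"
        using C(4) by blast
      then obtain i where "i \<in> ?I" "x = c i" using c by (metis bij_betw_imp_surj_on imageE)
      then show "y \<in> (\<Union>i\<in>?I. bowen_ball {0..<1} f (Suc n) (c i) \<epsilon>)"
        using x y by (intro UN_I[of i]) (auto simp: bowen_ball_def)
    qed
  qed
  also have "\<dots> = ennreal (real (card C) * exp (- \<alpha> * real (Suc n)))"
    by (simp add: ennreal_mult' flip: ennreal_of_nat_eq_real_of_nat)
  also have "\<dots> \<le> ennreal (((1 / \<epsilon> + real n) * \<beta> ^ n + 1) * exp (- \<alpha> * real (Suc n)))"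
    using C(3) by (intro ennreal_leI mult_right_mono) auto
  finally show ?thesis .
qed

text \<open>The unit interval needs at most of order \<open>n * \<beta> ^ n\<close> Bowen balls of
  length \<open>Suc n\<close>, so at any exponent above \<open>ln \<beta>\<close> the cost of the
  cover tends to zero.\<close>

lemma h_top_eps_le:
  assumes "0 < \<epsilon>" "Z \<subseteq> {0..<1}"
  shows "h_top_eps {0..<1} f Z \<epsilon> \<le> ereal (ln \<beta>)"
proof (rule ereal_le_epsilon2)
  fix \<delta> :: real assume \<delta>: "0 < \<delta>"
  define \<alpha> where "\<alpha> = ln \<beta> + \<delta>"
  let ?b = "\<lambda>n. ((1 / \<epsilon> + real n) * \<beta> ^ n + 1) * exp (- \<alpha> * real (Suc n))"
  have "?b \<longlonglongrightarrow> 0"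
  proof -
    have "\<alpha> > 0" unfolding \<alpha>_def by (rule add_pos_pos[OF ln_gt_zero[OF beta_gt_1] \<delta>])
    have "?b = (\<lambda>n. exp (- \<alpha>) * ((1 / \<epsilon>) * exp (- \<delta>) ^ n + real n * exp (- \<delta>) ^ n + exp (- \<alpha>) ^ n))"
    proof
      fix n
      have "- \<alpha> = - \<delta> - ln \<beta>" by (simp add: \<alpha>_def)
      then have "exp (- \<alpha>) = exp (- \<delta>) / \<beta>" by (simp only: exp_diff exp_ln[OF beta_pos(1)])
      then have pw: "\<beta> ^ n * exp (- \<alpha>) ^ n = exp (- \<delta>) ^ n"
        by (simp flip: power_mult_distrib)
      have "exp (- \<alpha> * real (Suc n)) = exp (- \<alpha>) * exp (- \<alpha>) ^ n"
        by (simp only: mult.commute[of "- \<alpha>"] exp_of_nat_mult power_Suc)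
      then have "?b n = exp (- \<alpha>) * ((1 / \<epsilon> + real n) * (\<beta> ^ n * exp (- \<alpha>) ^ n) + exp (- \<alpha>) ^ n)"
        by (simp only: ring_distribs mult_ac mult_1_left mult_1_right)
      then show "?b n = exp (- \<alpha>) * ((1 / \<epsilon>) * exp (- \<delta>) ^ n + real n * exp (- \<delta>) ^ n + exp (- \<alpha>) ^ n)"
        by (simp only: pw ring_distribs)
    qed
    moreover have "(\<lambda>n. exp (- \<alpha>) * ((1 / \<epsilon>) * exp (- \<delta>) ^ n + real n * exp (- \<delta>) ^ n + exp (- \<alpha>) ^ n))
      \<longlonglongrightarrow> exp (- \<alpha>) * ((1 / \<epsilon>) * 0 + 0 + 0)"
      using \<delta> \<open>\<alpha> > 0\<close>
      by (intro tendsto_mult tendsto_add tendsto_const LIMSEQ_power_zero powser_times_n_limit_0) auto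
    ultimately show ?thesis by simp
  qed
  then have lim: "(\<lambda>n. ennreal (?b n)) \<longlonglongrightarrow> 0"
    using tendsto_ennrealI[of ?b 0 sequentially] by simp
  have "ent_M {0..<1} f Z \<alpha> \<epsilon> N \<le> 0" for N
  proof (rule LIMSEQ_le_const[OF lim], intro exI allI impI)
    fix n assume "N \<le> n"
    then have "ent_M {0..<1} f Z \<alpha> \<epsilon> N \<le> ent_M {0..<1} f Z \<alpha> \<epsilon> (Suc n)"
      by (intro incseqD[OF incseq_ent_M]) simp
    also note ent_M_le[OF assms]
    finally show "ent_M {0..<1} f Z \<alpha> \<epsilon> N \<le> ennreal (?b n)" .
  qed
  then have "ent_m {0..<1} f Z \<alpha> \<epsilon> = 0" unfolding ent_m_eq_SUP by simp
  then show "h_top_eps {0..<1} f Z \<epsilon> \<le> ereal (ln \<beta>) + ereal \<delta>"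
    unfolding h_top_eps_def by (intro Inf_lower) (auto simp: \<alpha>_def)
qed

section \<open>The lower bound for the irregular set\<close>

lemma h_top_eps_irregular_ge:
  assumes cont: "continuous_on {0..1} \<phi>" and ne: "irregular_set {0..<1} f \<phi> \<noteq> {}"
    and h: "0 \<le> h" "h < ln \<beta>" and \<epsilon>: "\<epsilon> \<le> 1 / (2 * (1 + \<beta>))"
  shows "ereal h \<le> h_top_eps {0..<1} f (irregular_set {0..<1} f \<phi>) \<epsilon>"
proof -
  obtain x where x: "x \<in> {0..<1}" "\<not> convergent (\<lambda>n. birkhoff \<phi> n x / real n)"
    using ne by (auto simp: irregular_set_def birkhoff_def)
  obtain M where M: "\<And>n. \<bar>birkhoff \<phi> n x\<bar> \<le> real n * M"
    using birkhoff_bounded[OF cont] x(1) by meson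
  have M': "\<bar>birkhoff \<phi> n x / real n\<bar> \<le> \<bar>M\<bar>" for n
  proof (cases "n = 0")
    case False
    have "\<bar>birkhoff \<phi> n x\<bar> \<le> real n * \<bar>M\<bar>"
      by (rule order_trans[OF M mult_left_mono]) auto
    with False show ?thesis by (simp add: pos_divide_le_eq mult.commute)
  qed simp
  obtain a0 b0 where ab0: "a0 < b0"
    and lo: "\<exists>\<^sub>F n in sequentially. birkhoff \<phi> n x / real n < a0"
    and hi: "\<exists>\<^sub>F n in sequentially. b0 < birkhoff \<phi> n x / real n"
    by (rule nonconvergent_bounded_gap[OF x(2) M'])
  \<comment> \<open>The margins of one third on each side are spent in passing from the orbit of
    \<open>x\<close> to the full words \<open>p\<close> and \<open>q\<close>.\<close>
  define a where "a = a0 + (b0 - a0) / 3"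
  define b where "b = b0 - (b0 - a0) / 3"
  have ab: "a0 < a" "a < b" "b < b0" using ab0 by (simp_all add: a_def b_def field_simps)
  obtain n1 p where p: "0 < n1" "p \<in> full_words n1"
    "\<And>y. y \<in> cyl n1 p \<Longrightarrow> birkhoff \<phi> n1 y \<le> a * real n1"
    using ex_full_word_birkhoff_le[OF cont x(1) ab(1) lo] by metis
  have "\<exists>\<^sub>F n in sequentially. birkhoff (\<lambda>x. - \<phi> x) n x / real n < - b0"
    using hi by (simp add: birkhoff_uminus)
  moreover have "continuous_on {0..1} (\<lambda>x. - \<phi> x)" using cont by (intro continuous_intros)
  ultimately obtain n2 q where q: "0 < n2" "q \<in> full_words n2"
    "\<And>y. y \<in> cyl n2 q \<Longrightarrow> birkhoff (\<lambda>x. - \<phi> x) n2 y \<le> - b * real n2"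
    using ex_full_word_birkhoff_le[OF _ x(1), of "\<lambda>x. - \<phi> x" "- b0" "- b"] ab(3) by (metis neg_less_iff_less)

  \<comment> \<open>\<open>D\<close> is the ratio of the length \<open>m\<close> of the free word to
    the length \<open>l\<close> of the appended block. It is so large that the diluted rate
    \<open>D / (D + 1) * ln \<beta>\<close> still exceeds \<open>h\<close>; \<open>\<delta>\<close>
    is the surplus per unit of \<open>l\<close>.\<close>
  obtain D0 :: nat where D0: "ln \<beta> / (ln \<beta> - h) < real D0" using reals_Archimedean2 by blast
  define D where "D = Suc D0"
  define \<delta> where "\<delta> = real D * ln \<beta> - h * (real D + 1)"
  have "ln \<beta> < real D0 * (ln \<beta> - h)" using D0 h(2) by (simp add: pos_divide_less_eq)
  then have \<delta>: "0 < \<delta>" using h by (simp add: \<delta>_def D_def algebra_simps)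
  have D: "0 < D" by (simp add: D_def)
  \<comment> \<open>Since \<open>T + m = c * l\<close>, the modulus errors entering \<open>e\<close>
    and \<open>g\<close> add up to exactly half of \<open>(b - a) * l\<close> with this
    \<open>\<eta>\<close>.\<close>
  define c where "c = 2 * real D + 1"
  have "0 < c" by (simp add: c_def)
  define \<eta> where "\<eta> = (b - a) / (2 * c)"
  have \<eta>: "0 < \<eta>" "c * \<eta> = (b - a) / 2"
    using ab(2) \<open>0 < c\<close> by (simp_all add: \<eta>_def)
  obtain K where K: "0 \<le> K"
    "\<And>u v. u \<in> {0..1} \<Longrightarrow> v \<in> {0..1} \<Longrightarrow> \<bar>\<phi> u - \<phi> v\<bar> \<le> \<eta> + K * dist u v"
    by (rule compact_modulus_of_continuity[OF compact_Icc cont \<eta>(1)]) auto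
  define L where "L = K * (1 / (\<beta> - 1))"
  have near: "\<bar>birkhoff \<phi> n y - birkhoff \<phi> n z\<bar> \<le> real n * \<eta> + L"
    if "full n v" "y \<in> cyl n v" "z \<in> cyl n v" for n v y z
    unfolding L_def using cyl_subset[OF that(1)] that
    by (intro birkhoff_diff_le[OF K(2) _ _ K(1) orbit_dist_cyl]) auto

  \<comment> \<open>The first bound makes \<open>exp (\<delta> * l)\<close> beat the loss factor
    \<open>m + 1\<close> in the count of full words; the second makes the constants
    \<open>2 * L\<close> smaller than the other half of \<open>(b - a) * l\<close>.\<close>
  obtain r :: nat where "max (2 * real D / \<delta>\<^sup>2) (4 * L / (b - a)) < real r"
    using reals_Archimedean2 by blast
  then have r: "2 * real D / \<delta>\<^sup>2 < real r" "4 * L / (b - a) < real r" by simp_all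
  have "0 \<le> 2 * real D / \<delta>\<^sup>2" by simp
  then have "0 < real r" using r(1) by (rule le_less_trans)
  then have r0: "0 < r" by simp
  \<comment> \<open>A common multiple of \<open>n1\<close> and \<open>n2\<close>, so that powers of
    \<open>p\<close> and \<open>q\<close> reach the same length.\<close>
  define l where "l = r * (n1 * n2)"
  have lr: "r \<le> l" "0 < l" using p(1) q(1) r0 by (auto simp: l_def)
  obtain P where P: "P \<in> full_words l" "\<And>y. y \<in> cyl l P \<Longrightarrow> birkhoff \<phi> l y \<le> a * real l"
    using ex_full_word_repeat[OF p(2,3), of "r * n2"] r0 q(1)
    unfolding l_def mult.assoc mult.commute[of n1] by (metis nat_0_less_mult_iff)
  \<comment> \<open>As for \<open>q\<close>, a lower bound on sums of \<open>\<phi>\<close> is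
    expressed as an upper bound for \<open>- \<phi>\<close>.\<close>
  obtain Q where Q: "Q \<in> full_words l" "\<And>y. y \<in> cyl l Q \<Longrightarrow> birkhoff (\<lambda>x. - \<phi> x) l y \<le> - b * real l"
    using ex_full_word_repeat[OF q(2,3), of "r * n1"] r0 p(1)
    unfolding l_def mult.assoc by (metis nat_0_less_mult_iff)
  have fP: "full l P" and fQ: "full l Q" using P Q by (auto simp: full_words_def)
  define m where "m = D * l"
  define T where "T = m + l"
  have m0: "0 < m" using D lr by (simp add: m_def)
  let ?U = "full_words m"
  define A where "A = (\<lambda>u. u + P / \<beta> ^ m)"
  define B where "B = (\<lambda>u. u + Q / \<beta> ^ m)"
  have fU: "full m u" if "u \<in> ?U" for u using that by (simp add: full_words_def)
  have A: "A u \<in> full_words T" and B: "B u \<in> full_words T" if "u \<in> ?U" for u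
    unfolding A_def B_def T_def using full_words_append[OF fU[OF that]] P(1) Q(1) by auto
  have cA: "y \<in> cyl m u" "birkhoff \<phi> T y \<le> birkhoff \<phi> m y + a * real l"
    if "u \<in> ?U" "y \<in> cyl T (A u)" for u y
    using cyl_append_subset[OF fU[OF that(1)] fP] that P(2)
    by (auto simp: A_def T_def birkhoff_add)
  have cB: "y \<in> cyl m u" "birkhoff \<phi> m y + b * real l \<le> birkhoff \<phi> T y"
    if "u \<in> ?U" "y \<in> cyl T (B u)" for u y
    using cyl_append_subset[OF fU[OF that(1)] fQ] that Q(2)
    by (auto simp: B_def T_def birkhoff_add birkhoff_uminus)
  define e where "e = real T * \<eta> + L"
  define g where "g = (b - a) * real l - (real m * \<eta> + L)"
  have "real T * \<eta> + real m * \<eta> = real l * (c * \<eta>)"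
    by (simp add: c_def T_def m_def algebra_simps)
  also have "\<dots> = real l * (b - a) / 2" by (simp add: \<eta>(2))
  finally have sum: "real T * \<eta> + real m * \<eta> = real l * (b - a) / 2" .
  have "4 * L < real r * (b - a)" using r ab(2) by (simp add: pos_divide_less_eq)
  also have "\<dots> \<le> real l * (b - a)" using lr ab(2) by (intro mult_right_mono) auto
  finally have eg: "e < g" using sum by (simp add: e_def g_def algebra_simps)

  have "\<exists>y. y \<in> irregular_set {0..<1} f \<phi> \<and> (\<forall>k. (f ^^ (k * T)) y \<in> cyl m (u k))"
    if u: "\<forall>k. u k \<in> ?U" for u
  proof -
    have T: "0 < T" using lr by (simp add: T_def)
    have "\<exists>w. (\<forall>k. w k \<in> {A (u k), B (u k)}) \<and> coded_point T w \<in> irregular_set {0..<1} f \<phi>"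
    proof (rule ex_irregular_coded_point[OF cont T _ _ eg])
      fix k y z
      note uk = u[rule_format, of k]
      show "A (u k) \<in> full_words T" "B (u k) \<in> full_words T" using A B uk by auto
      assume y: "y \<in> cyl T (A (u k))"
      show "birkhoff \<phi> T z - birkhoff \<phi> T y \<le> e" if z: "z \<in> cyl T (A (u k))"
        using near[OF _ y z] A[OF uk] by (simp add: full_words_def e_def)
      show "g \<le> birkhoff \<phi> T z - birkhoff \<phi> T y" if z: "z \<in> cyl T (B (u k))"
        using near[OF fU[OF uk] cA(1)[OF uk y] cB(1)[OF uk z]] cA(2)[OF uk y] cB(2)[OF uk z]
        by (simp add: g_def algebra_simps)
    qed
    then obtain w where w: "\<forall>k. w k \<in> {A (u k), B (u k)}" "coded_point T w \<in> irregular_set {0..<1} f \<phi>"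
      by blast
    have wT: "w k \<in> full_words T" for k using w(1) A B u by (metis insertE singletonD)
    have "(f ^^ (k * T)) (coded_point T w) \<in> cyl m (u k)" for k
      unfolding coded_point_shift(1)[where w = w, OF T wT]
      using coded_point_shift(2)[where w = w and k = k, OF T wT] w(1)[rule_format, of k]
        cA(1)[of "u k"] cB(1)[of "u k"] u by auto
    then show ?thesis using w(2) by blast
  qed
  then obtain pt where pt: "\<And>u. \<forall>k. u k \<in> ?U \<Longrightarrow> pt u \<in> irregular_set {0..<1} f \<phi>"
    "\<And>u k. \<forall>k. u k \<in> ?U \<Longrightarrow> (f ^^ (k * T)) (pt u) \<in> cyl m (u k)"
    by metis

  have "exp (h * real T) * (real m + 1) \<le> real (card ?U) * (real m + 1)"
  proof -
    have pos: "0 \<le> \<delta> * real l" using \<delta> by simp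
    have "real D * 2 < real r * \<delta>\<^sup>2" using r \<delta> by (simp add: pos_divide_less_eq)
    also have "\<dots> \<le> real l * \<delta>\<^sup>2" using lr by (intro mult_right_mono) auto
    finally have "real D * 2 * real l \<le> real l * \<delta>\<^sup>2 * real l" by (intro mult_right_mono) auto
    then have "real m + 1 \<le> 1 + (\<delta> * real l)\<^sup>2 / 2" by (simp add: m_def power2_eq_square algebra_simps)
    also have "\<dots> \<le> exp (\<delta> * real l)"
      using exp_lower_Taylor_quadratic[OF pos] pos by linarith
    finally have "exp (h * real T) * (real m + 1) \<le> exp (h * real T) * exp (\<delta> * real l)" by simp
    \<comment> \<open>By the choice of \<open>\<delta>\<close>,
      \<open>h * T + \<delta> * l = m * ln \<beta>\<close>.\<close>
    also have "\<dots> = exp (real m * ln \<beta>)"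
      by (simp add: exp_add[symmetric] \<delta>_def T_def m_def algebra_simps)
    also have "\<dots> = \<beta> ^ m" using beta_gt_1 by (simp add: exp_of_nat_mult)
    also note card_full_words_ge[OF m0]
    finally show ?thesis by (simp only: mult.commute)
  qed
  then have card: "exp (h * real T) \<le> real (card ?U)" by (simp add: mult_le_cancel_right)
  have "0 < real (card ?U)" using card exp_gt_zero[of "h * real T"] by linarith
  then have "?U \<noteq> {}" by auto
  then show ?thesis
    using lr(2) by (intro h_top_eps_ge[OF finite_full_words _ fU _ pt h(1) card \<epsilon>]) (auto simp: T_def)
qed

end

theorem theorem5p1:
  fixes \<beta> :: real and \<phi> :: "real \<Rightarrow> real"
  assumes "\<beta> > 1"
    and "continuous_on {0..1} \<phi>"
    and "irregular_set {0..<1} (beta_map \<beta>) \<phi> \<noteq> {}"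
  shows "h_top {0..<1} (beta_map \<beta>) (irregular_set {0..<1} (beta_map \<beta>) \<phi>) = ereal (ln \<beta>)"
proof -
  interpret beta_transformation \<beta> by unfold_locales (rule assms(1))
  let ?Z = "irregular_set {0..<1} f \<phi>"
  \<comment> \<open>\<open>h_top\<close> is a supremum over scales, so this single scale suffices
    for the lower bound.\<close>
  let ?\<epsilon> = "1 / (2 * (1 + \<beta>))"
  have "h_top {0..<1} f ?Z \<le> ereal (ln \<beta>)"
    unfolding h_top_eq_SUP by (intro SUP_least h_top_eps_le) (auto simp: irregular_set_def)
  moreover have "ereal (ln \<beta>) \<le> h_top {0..<1} f ?Z"
  proof (rule dense_le_bounded)
    show "0 < ereal (ln \<beta>)" using assms(1) by simp
    fix h assume h: "0 < h" "h < ereal (ln \<beta>)"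
    then obtain r where r: "h = ereal r" by (cases h) auto
    have "h \<le> h_top_eps {0..<1} f ?Z ?\<epsilon>"
      unfolding r using h r by (intro h_top_eps_irregular_ge assms) auto
    also have "\<dots> \<le> h_top {0..<1} f ?Z"
      unfolding h_top_eq_SUP using assms(1) by (intro SUP_upper) simp
    finally show "h \<le> h_top {0..<1} f ?Z" .
  qed
  ultimately show ?thesis by (rule antisym)
qed

end
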